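(* If a 4-dimensional strictly causal flat complete Lorentzian manifold is not elliptic, then it is homothetic to the manifold $M_{0}=\mathbb R^4/\Gamma_0$ defined as follows. On $\mathbb R^4$ with coordinates $v=(v_0,v_1,v_2,v_3)^\top$ take the Lorentzian form $\ell_0(v,v)=2v_0v_3-v_1^2-v_2^2$, and let $\Gamma_0=\{\gamma_n\}_{n\in\mathbb Z}$ (an infinite cyclic group) act by $$\gamma_n(v)=\begin{pmatrix}1&0&n&\frac{n^2}{2}\\ 0&1&0&0\\ 0&0&1&n\\ 0&0&0&1\end{pmatrix}v+\begin{pmatrix}0\\ {n}\\ 0\\ 0\end{pmatrix}.$$
   Context: Setting. $V$ is a real vector space of dimension $n$ with a Lorentzian symmetric bilinear form $\ell$ of signature $(+,-,\dots,-)$. The set $\{v:\ell(v,v)\ge 0\}$ is the union of two closed convex round cones $C$ and $-C$; $C$ is one of them, fixed. A flat complete Lorentzian manifold is a quotient $M=V/\Gamma$ where $\Gamma$ is a discrete group acting freely and properly on $V$ by affine transformations $\gamma(v)=\lambda(\gamma)v+\tau(\gamma)$, $\tau(\gamma)\in V$, whose linear parts $\lambda(\gamma)$ preserve $\ell$ and $C$. Let $\kappa:V\to M$ be the quotient map and $G=\lambda(\Gamma)$. For $p=\kappa(v)$, the past and the future of $p$ are $P_p=\kappa(v-C)$ and $F_p=\kappa(v+C)$. The cone $C$ induces a field of cones $C_p=d_v\kappa(C)\subset T_pM$. A piecewise smooth path $\eta$ in $M$ is timelike if $\eta'(t)\in C_{\eta(t)}$ for all $t$. $M$ is causal if it admits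 no nonconstant closed piecewise smooth timelike path; equivalently, $\gamma(v)\in v+C$ with $v\in V$, $\gamma\in\Gamma$ implies $\gamma=e$. $M$ is strictly causal if it is causal and every $p\in M$ has a neighbourhood $U_p$ such that $U_p\cap F_p$ and $U_p\cap P_p$ are closed in $U_p$. $M$ is elliptic if $G$ has a fixed point in $\mathrm{Int}(C)$. Lorentzian manifolds $(M_1,\ell_1)$ and $(M_2,\ell_2)$ are homothetic if there is $t>0$ such that $(M_1,t\ell_1)$ and $(M_2,\ell_2)$ are isometric. *)

theory Defs
  imports "HOL-Analysis.Analysis"
begin

subsection \<open>Smooth maps on open subsets of normed spaces\<close>

text \<open>\<open>higher_differentiable_on n U f\<close> says that \<open>f\<close> is of class \<open>C\<^sup>n\<close> on the open set \<open>U\<close>,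
  expressed through iterated directional derivatives; it is meaningful for open \<open>U\<close> in a
  finite-dimensional domain.\<close>

primrec higher_differentiable_on ::
    "nat \<Rightarrow> 'a::real_normed_vector set \<Rightarrow> ('a \<Rightarrow> 'b::real_normed_vector) \<Rightarrow> bool" where
  "higher_differentiable_on 0 U f \<longleftrightarrow> continuous_on U f"
| "higher_differentiable_on (Suc n) U f \<longleftrightarrow>
     (\<forall>x\<in>U. f differentiable (at x)) \<and>
     (\<forall>h. higher_differentiable_on n U (\<lambda>x. frechet_derivative f (at x) h))"

definition smooth_on :: "'a::real_normed_vector set \<Rightarrow> ('a \<Rightarrow> 'b::real_normed_vector) \<Rightarrow> bool" where
  "smooth_on U f \<longleftrightarrow> (\<forall>n. higher_differentiable_on n U f)"


subsection \<open>Lorentzian forms and time cones\<close>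

definition lorentzian_form :: "('a::euclidean_space \<Rightarrow> 'a \<Rightarrow> real) \<Rightarrow> bool" where
  "lorentzian_form l \<longleftrightarrow>
     bilinear l \<and> (\<forall>x y. l x y = l y x) \<and>
     (\<exists>B e. independent B \<and> span B = UNIV \<and> e \<in> B \<and> l e e = 1 \<and>
        (\<forall>b\<in>B - {e}. l b b = -1) \<and> (\<forall>b\<in>B. \<forall>c\<in>B. b \<noteq> c \<longrightarrow> l b c = 0))"

text \<open>In dimension at least two, exactly two sets satisfy the following predicate for a given
  Lorentzian form, and they are opposite to each other: the closed solid cones whose
  union is \<open>{v. l v v \<ge> 0}\<close>.\<close>

definition time_cone :: "('a::euclidean_space \<Rightarrow> 'a \<Rightarrow> real) \<Rightarrow> 'a set \<Rightarrow> bool" where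
  "time_cone l C \<longleftrightarrow>
     closed C \<and> convex C \<and> cone C \<and>
     C \<union> uminus ` C = {v. l v v \<ge> 0} \<and> C \<inter> uminus ` C = {0}"


subsection \<open>Flat complete Lorentzian manifolds\<close>

definition linear_part :: "('a::real_vector \<Rightarrow> 'a) \<Rightarrow> 'a \<Rightarrow> 'a" where
  "linear_part g = (\<lambda>v. g v - g 0)"

text \<open>The group \<open>\<Gamma>\<close> is a set of affine transformations. Its topology is the discrete one, so a
  proper action is one for which only finitely many elements move a given compact set to a set
  meeting it. The manifold \<open>V/\<Gamma>\<close> is given by the triple \<open>l\<close>, \<open>C\<close>, \<open>\<Gamma>\<close>; its points are the
  orbits, its topology is \<open>orbit_topology \<Gamma>\<close>, and its charts are the local inverses of
  \<open>orbit \<Gamma>\<close>, the quotient map.\<close>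

definition flat_complete_lorentzian ::
    "('a::euclidean_space \<Rightarrow> 'a \<Rightarrow> real) \<Rightarrow> 'a set \<Rightarrow> ('a \<Rightarrow> 'a) set \<Rightarrow> bool" where
  "flat_complete_lorentzian l C \<Gamma> \<longleftrightarrow>
     lorentzian_form l \<and> time_cone l C \<and>
     id \<in> \<Gamma> \<and> (\<forall>g\<in>\<Gamma>. \<forall>h\<in>\<Gamma>. g \<circ> h \<in> \<Gamma>) \<and> (\<forall>g\<in>\<Gamma>. bij g \<and> inv g \<in> \<Gamma>) \<and>
     (\<forall>g\<in>\<Gamma>. linear (linear_part g) \<and>
        (\<forall>x y. l (linear_part g x) (linear_part g y) = l x y) \<and> linear_part g ` C = C) \<and>
     (\<forall>g\<in>\<Gamma>. \<forall>v. g v = v \<longrightarrow> g = id) \<and>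
     (\<forall>K. compact K \<longrightarrow> finite {g \<in> \<Gamma>. g ` K \<inter> K \<noteq> {}})"

definition orbit :: "('a \<Rightarrow> 'a) set \<Rightarrow> 'a \<Rightarrow> 'a set" where
  "orbit \<Gamma> v = {g v |g. g \<in> \<Gamma>}"

definition orbit_space :: "('a \<Rightarrow> 'a) set \<Rightarrow> 'a set set" where
  "orbit_space \<Gamma> = range (orbit \<Gamma>)"

definition orbit_topology :: "('a::topological_space \<Rightarrow> 'a) set \<Rightarrow> 'a set topology" where
  "orbit_topology \<Gamma> = topology (\<lambda>W. W \<subseteq> orbit_space \<Gamma> \<and> open (orbit \<Gamma> -` W))"

lemma openin_orbit_topology:
  "openin (orbit_topology \<Gamma>) W \<longleftrightarrow> W \<subseteq> orbit_space \<Gamma> \<and> open (orbit \<Gamma> -` W)"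
proof -
  have "istopology (\<lambda>W. W \<subseteq> orbit_space \<Gamma> \<and> open (orbit \<Gamma> -` W))"
    unfolding istopology_def
    by (auto simp: vimage_Union intro!: open_Int open_UN)
  then show ?thesis
    by (simp add: orbit_topology_def)
qed

text \<open>For \<open>\<phi>\<close> with values in \<open>V/\<Gamma>\<close>, defined on \<open>S\<close>, a smooth lift over the open set \<open>U\<close> is a smooth
  map on all of \<open>U\<close> that lifts \<open>\<phi>\<close> on \<open>U \<inter> S\<close>. Since the quotient map is a local diffeomorphism,
  such lifts are \<open>\<phi>\<close> read in charts, and their derivatives represent the derivatives of \<open>\<phi>\<close>.\<close>

definition smooth_lift ::
    "('a::euclidean_space \<Rightarrow> 'a) set \<Rightarrow> ('b::euclidean_space \<Rightarrow> 'a set) \<Rightarrow> 'b set \<Rightarrow> 'b set \<Rightarrow>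
     ('b \<Rightarrow> 'a) \<Rightarrow> bool" where
  "smooth_lift \<Gamma> \<phi> S U F \<longleftrightarrow>
     open U \<and> smooth_on U F \<and> (\<forall>u\<in>U \<inter> S. \<phi> u = orbit \<Gamma> (F u))"


subsection \<open>Causality\<close>

text \<open>Timelike is understood in the wide sense: the velocity lies in the closed cone, and may
  vanish. The set \<open>T\<close> contains the break points of the path; \<open>\<eta>\<close> is smooth and timelike on each
  closed interval between two consecutive points of \<open>T\<close>, hence continuous on \<open>{a..b}\<close>.\<close>

definition smooth_timelike_on ::
    "'a::euclidean_space set \<Rightarrow> ('a \<Rightarrow> 'a) set \<Rightarrow> real set \<Rightarrow> (real \<Rightarrow> 'a set) \<Rightarrow> bool" where
  "smooth_timelike_on C \<Gamma> I \<eta> \<longleftrightarrow>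
     (\<forall>s\<in>I. \<exists>J c. s \<in> J \<and> smooth_lift \<Gamma> \<eta> I J c \<and> vector_derivative c (at s) \<in> C)"

definition timelike_path ::
    "'a::euclidean_space set \<Rightarrow> ('a \<Rightarrow> 'a) set \<Rightarrow> real \<Rightarrow> real \<Rightarrow> (real \<Rightarrow> 'a set) \<Rightarrow> bool" where
  "timelike_path C \<Gamma> a b \<eta> \<longleftrightarrow>
     a < b \<and>
     (\<exists>T. finite T \<and> T \<subseteq> {a..b} \<and> a \<in> T \<and> b \<in> T \<and>
        (\<forall>s\<in>T. \<forall>t\<in>T. s < t \<and> T \<inter> {s<..<t} = {} \<longrightarrow> smooth_timelike_on C \<Gamma> {s..t} \<eta>))"

definition causal :: "'a::euclidean_space set \<Rightarrow> ('a \<Rightarrow> 'a) set \<Rightarrow> bool" where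
  "causal C \<Gamma> \<longleftrightarrow>
     \<not> (\<exists>a b \<eta>. timelike_path C \<Gamma> a b \<eta> \<and> \<eta> a = \<eta> b \<and> (\<exists>s\<in>{a..b}. \<eta> s \<noteq> \<eta> a))"

text \<open>The past and the future of the point \<open>orbit \<Gamma> v\<close>; they do not depend on the choice of \<open>v\<close>
  in its orbit.\<close>

definition past_of :: "'a::euclidean_space set \<Rightarrow> ('a \<Rightarrow> 'a) set \<Rightarrow> 'a \<Rightarrow> 'a set set" where
  "past_of C \<Gamma> v = orbit \<Gamma> ` ((\<lambda>c. v - c) ` C)"

definition future_of :: "'a::euclidean_space set \<Rightarrow> ('a \<Rightarrow> 'a) set \<Rightarrow> 'a \<Rightarrow> 'a set set" where
  "future_of C \<Gamma> v = orbit \<Gamma> ` ((\<lambda>c. v + c) ` C)"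

definition strictly_causal :: "'a::euclidean_space set \<Rightarrow> ('a \<Rightarrow> 'a) set \<Rightarrow> bool" where
  "strictly_causal C \<Gamma> \<longleftrightarrow>
     causal C \<Gamma> \<and>
     (\<forall>v. \<exists>U. openin (orbit_topology \<Gamma>) U \<and> orbit \<Gamma> v \<in> U \<and>
        closedin (subtopology (orbit_topology \<Gamma>) U) (U \<inter> future_of C \<Gamma> v) \<and>
        closedin (subtopology (orbit_topology \<Gamma>) U) (U \<inter> past_of C \<Gamma> v))"

definition elliptic :: "'a::euclidean_space set \<Rightarrow> ('a \<Rightarrow> 'a) set \<Rightarrow> bool" where
  "elliptic C \<Gamma> \<longleftrightarrow> (\<exists>v\<in>interior C. \<forall>g\<in>\<Gamma>. linear_part g v = v)"


subsection \<open>Isometric and homothetic manifolds\<close>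

text \<open>A map \<open>f\<close> between orbit spaces is smooth iff \<open>f \<circ> orbit \<Gamma>\<close> is, and the differential of a
  local lift of \<open>f \<circ> orbit \<Gamma>\<close> represents the differential of \<open>f\<close>.\<close>

definition smooth_orbit_map ::
    "('a::euclidean_space \<Rightarrow> 'a) set \<Rightarrow> ('b::euclidean_space \<Rightarrow> 'b) set \<Rightarrow> ('a set \<Rightarrow> 'b set) \<Rightarrow> bool"
    where
  "smooth_orbit_map \<Gamma> \<Gamma>' f \<longleftrightarrow>
     (\<forall>v. \<exists>U F. v \<in> U \<and> smooth_lift \<Gamma>' (f \<circ> orbit \<Gamma>) UNIV U F)"

definition isometry ::
    "('a::euclidean_space \<Rightarrow> 'a) set \<Rightarrow> ('a \<Rightarrow> 'a \<Rightarrow> real) \<Rightarrow>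
     ('b::euclidean_space \<Rightarrow> 'b) set \<Rightarrow> ('b \<Rightarrow> 'b \<Rightarrow> real) \<Rightarrow> ('a set \<Rightarrow> 'b set) \<Rightarrow> bool" where
  "isometry \<Gamma> l \<Gamma>' l' f \<longleftrightarrow>
     bij_betw f (orbit_space \<Gamma>) (orbit_space \<Gamma>') \<and>
     smooth_orbit_map \<Gamma> \<Gamma>' f \<and>
     smooth_orbit_map \<Gamma>' \<Gamma> (the_inv_into (orbit_space \<Gamma>) f) \<and>
     (\<forall>v. \<exists>U F. v \<in> U \<and> smooth_lift \<Gamma>' (f \<circ> orbit \<Gamma>) UNIV U F \<and>
        (\<forall>x y. l' (frechet_derivative F (at v) x) (frechet_derivative F (at v) y) = l x y))"

definition homothetic ::
    "('a::euclidean_space \<Rightarrow> 'a) set \<Rightarrow> ('a \<Rightarrow> 'a \<Rightarrow> real) \<Rightarrow>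
     ('b::euclidean_space \<Rightarrow> 'b) set \<Rightarrow> ('b \<Rightarrow> 'b \<Rightarrow> real) \<Rightarrow> bool" where
  "homothetic \<Gamma> l \<Gamma>' l' \<longleftrightarrow> (\<exists>t>0. \<exists>f. isometry \<Gamma> (\<lambda>x y. t * l x y) \<Gamma>' l' f)"


subsection \<open>The model manifold\<close>

text \<open>The coordinates \<open>v\<^sub>0, v\<^sub>1, v\<^sub>2, v\<^sub>3\<close> are the components \<open>v $ 1, v $ 2, v $ 3, v $ 4\<close>. The form is the
  polarization of \<open>2 v\<^sub>0 v\<^sub>3 - v\<^sub>1\<^sup>2 - v\<^sub>2\<^sup>2\<close>.\<close>

definition form0 :: "real^4 \<Rightarrow> real^4 \<Rightarrow> real" where
  "form0 v w = v$1 * w$4 + v$4 * w$1 - v$2 * w$2 - v$3 * w$3"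

definition gamma0 :: "int \<Rightarrow> real^4 \<Rightarrow> real^4" where
  "gamma0 n v =
     (vector [vector [1, 0, of_int n, (of_int n)\<^sup>2 / 2],
              vector [0, 1, 0, 0],
              vector [0, 0, 1, of_int n],
              vector [0, 0, 0, 1]] :: real^4^4) *v v
     + vector [0, of_int n, 0, 0]"

definition Gamma0 :: "(real^4 \<Rightarrow> real^4) set" where
  "Gamma0 = range gamma0"

lemma vector_4:
  "(vector [x, y, z, w] :: ('a::zero)^4) $ 1 = x"
  "(vector [x, y, z, w] :: ('a::zero)^4) $ 2 = y"
  "(vector [x, y, z, w] :: ('a::zero)^4) $ 3 = z"
  "(vector [x, y, z, w] :: ('a::zero)^4) $ 4 = w"
  unfolding vector_def by simp_all

lemma form0_diag: "form0 v v = 2 * v$1 * v$4 - (v$2)\<^sup>2 - (v$3)\<^sup>2"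
  by (simp add: form0_def power2_eq_square)

lemma gamma0_components:
  "gamma0 n v $ 1 = v$1 + of_int n * v$3 + (of_int n)\<^sup>2 / 2 * v$4"
  "gamma0 n v $ 2 = v$2 + of_int n"
  "gamma0 n v $ 3 = v$3 + of_int n * v$4"
  "gamma0 n v $ 4 = v$4"
  by (simp_all add: gamma0_def matrix_vector_mult_def sum_4 vector_4)

end

theory Submission
  imports Defs
begin

text \<open>
  Causality makes \<open>\<gamma> v - \<delta> v\<close> spacelike for distinct \<open>\<gamma>, \<delta> \<in> \<Gamma>\<close>, hence \<open>l (m w - w) (m w - w) \<le> 0\<close> for
  every linear part \<open>m\<close>. If \<open>G\<close> is bounded, the maximum of \<open>l v v\<close> on the convex hull of a timelike
  orbit is a fixed point in the interior of \<open>C\<close>. Otherwise rescaled orbits \<open>g\<^sub>n e\<close> and \<open>g\<^sub>n\<^sup>-\<^sup>1 e\<close> converge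
  to null vectors \<open>p\<close> and \<open>q\<close>, the inequality applied to \<open>g\<^sub>n k\<^sup>-\<^sup>1\<close> shows that \<open>k q\<close> is parallel to \<open>p\<close> for
  all \<open>k \<in> G\<close>, and \<open>G\<close> fixes \<open>p\<close>.

  In null coordinates \<open>(z\<^sub>0, z, z\<^sub>3)\<close> with \<open>z\<close> complex and \<open>z\<^sub>3 = l p\<close>, each \<open>\<gamma>\<close> then acts on \<open>z\<close> by
  \<open>\<epsilon> z + u z\<^sub>3 + a\<close> or \<open>\<epsilon> cnj z + u z\<^sub>3 + a\<close> and translates \<open>z\<^sub>3\<close> by \<open>b\<close>. Since \<open>G\<close> is unbounded, some
  \<open>\<gamma>\<close> has \<open>\<epsilon> = 1\<close> and \<open>u \<noteq> 0\<close>; commutators with it are translations along \<open>p\<close>, so trivial, and this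
  forces \<open>b = 0\<close> and \<open>\<epsilon> = 1\<close> for all orientation preserving elements. If \<open>u t + a\<close> came arbitrarily close to
  \<open>0\<close> for some fixed \<open>t\<close>, then by properness the corresponding cones would exhaust the half space \<open>z\<^sub>3 > t\<close>
  (or \<open>z\<^sub>3 < t\<close>), whose boundary meets the future (past) only in countably many lines, against strict
  causality. As commuting elements satisfy a symplectic relation, for any two of them there is a \<open>t\<close> at
  which the vectors \<open>u t + a\<close> are parallel, and Dirichlet approximation shows that \<open>\<Gamma>\<close> is cyclic. A
  generator is brought to normal form by an affine change of coordinates.
\<close>

subsection \<open>Affine conjugacies and homotheties\<close>

lemma higher_differentiable_on_const: "higher_differentiable_on n U (\<lambda>x. c)"
  by (induction n arbitrary: c) (auto simp: frechet_derivative_const)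

lemma frechet_derivative_affine:
  fixes A :: "'a::euclidean_space \<Rightarrow> 'b::real_normed_vector"
  assumes "linear A"
  shows "((\<lambda>x. A x + k) has_derivative A) (at x)" "frechet_derivative (\<lambda>x. A x + k) (at x) = A"
proof -
  have "bounded_linear A" using assms linear_conv_bounded_linear by blast
  then show "((\<lambda>x. A x + k) has_derivative A) (at x)"
    by (auto intro!: derivative_eq_intros bounded_linear_imp_has_derivative)
  then show "frechet_derivative (\<lambda>x. A x + k) (at x) = A"
    by (metis frechet_derivative_at)
qed

lemma smooth_on_affine:
  fixes A :: "'a::euclidean_space \<Rightarrow> 'b::real_normed_vector"
  assumes "linear A"
  shows "smooth_on U (\<lambda>x. A x + k)"
  unfolding smooth_on_def
proof
  fix n
  note d = frechet_derivative_affine[OF assms]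
  show "higher_differentiable_on n U (\<lambda>x. A x + k)"
  proof (cases n)
    case 0
    have "continuous_on U (\<lambda>x. A x + k)"
      by (intro continuous_at_imp_continuous_on ballI has_derivative_continuous[OF d(1)])
    then show ?thesis using 0 by simp
  next
    case (Suc m)
    have "(\<lambda>x. A x + k) differentiable (at x)" for x using d(1) differentiableI by blast
    then show ?thesis using Suc by (simp add: d(2) higher_differentiable_on_const)
  qed
qed

lemma orbit_self: "id \<in> \<Gamma> \<Longrightarrow> v \<in> orbit \<Gamma> v"
  unfolding orbit_def by (auto intro!: exI[of _ id])

lemma the_inv_into_image_inverse:
  assumes "inj_on f S" "\<And>X. X \<in> S \<Longrightarrow> h (f X) = X" "Y \<in> f ` S"
  shows "the_inv_into S f Y = h Y"
  using assms by (auto simp: the_inv_into_f_f)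

text \<open>Taking images under \<open>F\<close> carries orbits to orbits, because \<open>1\<close>
  and \<open>2\<close> make the two groups conjugate. \<open>F\<close> is a global smooth lift of
  the induced map with derivative \<open>A\<close> everywhere, so \<open>form\<close> is the
  isometry condition for \<open>\<tau> * l\<close>; \<open>inv F\<close> lifts the inverse.\<close>

lemma homothetic_of_affine_conjugacy:
  fixes l :: "'a::euclidean_space \<Rightarrow> 'a \<Rightarrow> real" and l' :: "'b::euclidean_space \<Rightarrow> 'b \<Rightarrow> real"
  assumes lin: "linear A" and F: "\<And>v. F v = A v + k" and bij: "bij F" and \<tau>: "\<tau> > 0"
    and form: "\<And>x y. l' (A x) (A y) = \<tau> * l x y"
    and 1: "\<And>g. g \<in> \<Gamma> \<Longrightarrow> \<exists>g'\<in>\<Gamma>'. \<forall>v. F (g v) = g' (F v)"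
    and 2: "\<And>g'. g' \<in> \<Gamma>' \<Longrightarrow> \<exists>g\<in>\<Gamma>. \<forall>v. F (g v) = g' (F v)"
  shows "homothetic \<Gamma> l \<Gamma>' l'"
proof -
  define f where "f X = F ` X" for X
  define h where "h Y = inv F ` Y" for Y
  have orb: "f (orbit \<Gamma> v) = orbit \<Gamma>' (F v)" for v
  proof
    show "f (orbit \<Gamma> v) \<subseteq> orbit \<Gamma>' (F v)" using 1 unfolding f_def orbit_def by blast
    show "orbit \<Gamma>' (F v) \<subseteq> f (orbit \<Gamma> v)"
    proof
      fix y assume "y \<in> orbit \<Gamma>' (F v)"
      then obtain g' where "g' \<in> \<Gamma>'" "y = g' (F v)" by (auto simp: orbit_def)
      then obtain g where "g \<in> \<Gamma>" "y = F (g v)" using 2 by metis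
      then show "y \<in> f (orbit \<Gamma> v)" unfolding f_def orbit_def by blast
    qed
  qed
  have hf: "h (f X) = X" for X using bij by (simp add: h_def f_def bij_is_inj image_inv_f_f)
  have surj: "F (inv F w) = w" for w using bij by (simp add: bij_is_surj surj_f_inv_f)
  have im: "f ` orbit_space \<Gamma> = orbit_space \<Gamma>'"
  proof
    show "f ` orbit_space \<Gamma> \<subseteq> orbit_space \<Gamma>'" by (auto simp: orbit_space_def orb)
    show "orbit_space \<Gamma>' \<subseteq> f ` orbit_space \<Gamma>"
      unfolding orbit_space_def using orb surj by (metis (no_types, lifting) image_subsetI rangeI image_eqI)
  qed
  have inj: "inj_on f S" for S using hf by (metis inj_on_def)
  have bijf: "bij_betw f (orbit_space \<Gamma>) (orbit_space \<Gamma>')" using im inj by (simp add: bij_betw_def)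
  have Feq: "F = (\<lambda>v. A v + k)" using F by blast
  have liftF: "smooth_lift \<Gamma>' (f \<circ> orbit \<Gamma>) UNIV UNIV F"
    unfolding smooth_lift_def Feq using smooth_on_affine[OF lin] orb Feq by auto
  have invA: "bij A"
  proof (rule bijI)
    show "inj A" using bij_is_inj[OF bij] unfolding Feq inj_def by simp
    show "surj A" unfolding surj_def
    proof
      fix y show "\<exists>x. y = A x" using surj[of "y + k"] unfolding F by (metis add_right_cancel)
    qed
  qed
  have invF: "inv F = (\<lambda>w. inv A w + (- inv A k))"
  proof
    fix w
    have "F (inv A w + (- inv A k)) = w"
      unfolding F using invA by (simp add: linear_diff[OF lin] bij_is_surj surj_f_inv_f)
    then show "inv F w = inv A w + (- inv A k)" using bij by (metis bij_is_inj inv_f_f)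
  qed
  have "A (inv A y) = y" for y using invA by (simp add: bij_is_surj surj_f_inv_f)
  then have lini: "linear (inv A)"
    by (intro linearI inv_f_eq[OF bij_is_inj[OF invA]]) (simp_all add: linear_add[OF lin] linear_scale[OF lin])
  have "h (orbit \<Gamma>' w) = orbit \<Gamma> (inv F w)" for w
    using orb[of "inv F w"] hf surj by metis
  moreover have "the_inv_into (orbit_space \<Gamma>) f (orbit \<Gamma>' w) = h (orbit \<Gamma>' w)" for w
    using the_inv_into_image_inverse[OF inj, of "orbit_space \<Gamma>" h] hf im by (auto simp: orbit_space_def)
  ultimately have liftG: "smooth_lift \<Gamma> (the_inv_into (orbit_space \<Gamma>) f \<circ> orbit \<Gamma>') UNIV UNIV (inv F)"
    unfolding smooth_lift_def using smooth_on_affine[OF lini, of UNIV "- inv A k"] by (simp add: invF)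
  have "isometry \<Gamma> (\<lambda>x y. \<tau> * l x y) \<Gamma>' l' f"
    unfolding isometry_def smooth_orbit_map_def
  proof (intro conjI allI)
    show "\<exists>U F. v \<in> U \<and> smooth_lift \<Gamma>' (f \<circ> orbit \<Gamma>) UNIV U F" for v using liftF by blast
    show "\<exists>U F. v \<in> U \<and> smooth_lift \<Gamma> (the_inv_into (orbit_space \<Gamma>) f \<circ> orbit \<Gamma>') UNIV U F" for v
      using liftG by blast
    fix v
    have "frechet_derivative F (at v) = A" unfolding Feq by (rule frechet_derivative_affine[OF lin])
    then show "\<exists>U F. v \<in> U \<and> smooth_lift \<Gamma>' (f \<circ> orbit \<Gamma>) UNIV U F \<and>
        (\<forall>x y. l' (frechet_derivative F (at v) x) (frechet_derivative F (at v) y) = \<tau> * l x y)"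
      using liftF form by (intro exI[of _ UNIV] exI[of _ F]) simp
  qed (rule bijf)
  then show ?thesis unfolding homothetic_def using \<tau> by blast
qed

subsection \<open>Causality of the group action\<close>

locale flat_lorentzian =
  fixes l :: "'a::euclidean_space \<Rightarrow> 'a \<Rightarrow> real" and C :: "'a set" and \<Gamma> :: "('a \<Rightarrow> 'a) set"
  assumes flat: "flat_complete_lorentzian l C \<Gamma>" and caus: "causal C \<Gamma>"
begin

lemma id_in: "id \<in> \<Gamma>"
  using flat by (simp add: flat_complete_lorentzian_def)

lemma comp_in: "g \<in> \<Gamma> \<Longrightarrow> h \<in> \<Gamma> \<Longrightarrow> g \<circ> h \<in> \<Gamma>"
  using flat by (simp add: flat_complete_lorentzian_def)

lemma inv_ex: "g \<in> \<Gamma> \<Longrightarrow> \<exists>h\<in>\<Gamma>. g \<circ> h = id \<and> h \<circ> g = id"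
proof -
  assume "g \<in> \<Gamma>"
  then have "bij g" "inv g \<in> \<Gamma>" using flat by (simp_all add: flat_complete_lorentzian_def)
  moreover have "g \<circ> inv g = id" using bij_is_surj[OF \<open>bij g\<close>] by (simp only: surj_iff)
  moreover have "inv g \<circ> g = id" using \<open>bij g\<close> by (simp add: bij_is_inj)
  ultimately show ?thesis by blast
qed

lemma lin: "g \<in> \<Gamma> \<Longrightarrow> linear (linear_part g)"
  using flat by (simp add: flat_complete_lorentzian_def)

lemma isom: "g \<in> \<Gamma> \<Longrightarrow> l (linear_part g x) (linear_part g y) = l x y"
  using flat by (simp add: flat_complete_lorentzian_def)

lemma pres: "g \<in> \<Gamma> \<Longrightarrow> linear_part g ` C = C"
  using flat by (simp add: flat_complete_lorentzian_def)

lemma free: "g \<in> \<Gamma> \<Longrightarrow> g v = v \<Longrightarrow> g = id"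
  using flat unfolding flat_complete_lorentzian_def by blast

lemma proper: "compact K \<Longrightarrow> finite {g \<in> \<Gamma>. g ` K \<inter> K \<noteq> {}}"
  using flat unfolding flat_complete_lorentzian_def by blast

lemma affine_eq: "g v = linear_part g v + g 0"
  by (simp add: linear_part_def)

lemma affine_diff: "g \<in> \<Gamma> \<Longrightarrow> g v - g w = linear_part g (v - w)"
  using linear_diff[OF lin, of g v w] by (simp add: linear_part_def)

lemma linear_part_comp: "g \<in> \<Gamma> \<Longrightarrow> linear_part (g \<circ> h) = linear_part g \<circ> linear_part h"
proof
  fix v
  assume g: "g \<in> \<Gamma>"
  show "linear_part (g \<circ> h) v = (linear_part g \<circ> linear_part h) v"
    using affine_diff[OF g, of "h v" "h 0"] by (simp add: linear_part_def)
qed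

lemma linear_part_id: "linear_part id = id"
  by (auto simp: linear_part_def)

lemma orbit_image: "g \<in> \<Gamma> \<Longrightarrow> orbit \<Gamma> (g v) = orbit \<Gamma> v"
proof -
  assume g: "g \<in> \<Gamma>"
  then obtain h where h: "h \<in> \<Gamma>" "h \<circ> g = id" using inv_ex by blast
  show ?thesis
  proof
    have "k (g v) = (k \<circ> g) v" for k by simp
    then show "orbit \<Gamma> (g v) \<subseteq> orbit \<Gamma> v" unfolding orbit_def using comp_in[OF _ g] by blast
    have "k v = (k \<circ> h) (g v)" for k using h(2) by (metis comp_apply id_apply)
    then show "orbit \<Gamma> v \<subseteq> orbit \<Gamma> (g v)" unfolding orbit_def using comp_in[OF _ h(1)] by blast
  qed
qed

text \<open>The segment from \<open>w\<close> to \<open>k w\<close> projects to a closed timelike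
  path. Causality excludes it once the path is known to be nonconstant, and that follows from
  properness.\<close>

lemma acausal:
  assumes k: "k \<in> \<Gamma>" and inC: "k w - w \<in> C"
  shows "k = id"
proof (rule ccontr)
  assume "k \<noteq> id"
  define d where "d = k w - w"
  have d: "d \<noteq> 0" using free[OF k] \<open>k \<noteq> id\<close> by (auto simp: d_def)
  define c where "c s = s *\<^sub>R d + w" for s :: real
  define \<eta> where "\<eta> s = orbit \<Gamma> (c s)" for s
  have lin: "linear (\<lambda>s. s *\<^sub>R d)" by (rule linearI) (simp_all add: scaleR_add_left)
  have "smooth_lift \<Gamma> \<eta> {0..1} UNIV c"
    unfolding smooth_lift_def \<eta>_def c_def using smooth_on_affine[OF lin] by simp
  moreover have "vector_derivative c (at s) = d" for s
  proof -
    have "(c has_vector_derivative d) (at s)"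
      unfolding c_def by (auto intro!: derivative_eq_intros)
    then show ?thesis by (rule vector_derivative_at)
  qed
  ultimately have "smooth_timelike_on C \<Gamma> {0..1} \<eta>"
    unfolding smooth_timelike_on_def using inC d_def by (metis UNIV_I)
  then have "timelike_path C \<Gamma> 0 1 \<eta>"
    unfolding timelike_path_def by (intro conjI exI[of _ "{0,1}"]) auto
  moreover have "\<eta> 0 = \<eta> 1" using orbit_image[OF k, of w] by (simp add: \<eta>_def c_def d_def)
  moreover have "\<exists>s\<in>{0..1}. \<eta> s \<noteq> \<eta> 0"
  proof (rule ccontr)
    \<comment> \<open>A constant path would put the whole segment into one orbit. Each of its points
      is then \<open>g w\<close> with \<open>g\<close> moving the compact set \<open>?K\<close> to a
      set that meets it, so the segment would be finite.\<close>
    assume n: "\<not> ?thesis"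
    let ?K = "c ` {0..1}"
    let ?S = "{g \<in> \<Gamma>. g ` ?K \<inter> ?K \<noteq> {}}"
    have "continuous_on {0..1} c" unfolding c_def by (intro continuous_intros)
    then have "finite ?S" by (intro proper compact_continuous_image) auto
    moreover have "?K \<subseteq> (\<lambda>g. g w) ` ?S"
    proof
      fix x assume x: "x \<in> ?K"
      then have "orbit \<Gamma> x = orbit \<Gamma> w" using n by (auto simp: \<eta>_def c_def)
      then have "x \<in> orbit \<Gamma> w" using orbit_self[OF id_in] by metis
      then obtain g where g: "g \<in> \<Gamma>" "x = g w" by (auto simp: orbit_def)
      have "w \<in> ?K" by (rule image_eqI[of _ _ 0]) (auto simp: c_def)
      then show "x \<in> (\<lambda>g. g w) ` ?S" using g x by blast
    qed
    ultimately have "finite ?K" using finite_surj by blast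
    moreover have "inj_on c {0..1}" using d by (auto simp: inj_on_def c_def)
    ultimately have "finite {0..1::real}" by (rule finite_imageD)
    then show False by (simp add: infinite_Icc)
  qed
  ultimately show False using caus unfolding causal_def by blast
qed

text \<open>Closed balls exhaust the space, and by properness each of them accounts for finitely
  many elements.\<close>

lemma countable_group: "countable \<Gamma>"
proof -
  have "\<Gamma> \<subseteq> (\<Union>n. {g \<in> \<Gamma>. g ` cball 0 (real n) \<inter> cball 0 (real n) \<noteq> {}})"
  proof
    fix g assume g: "g \<in> \<Gamma>"
    obtain n where "norm (g 0) \<le> real n" using real_arch_simple by blast
    then have "g 0 \<in> g ` cball 0 (real n) \<inter> cball 0 (real n)" by auto
    then show "g \<in> (\<Union>n. {g \<in> \<Gamma>. g ` cball 0 (real n) \<inter> cball 0 (real n) \<noteq> {}})" using g by blast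
  qed
  moreover have "countable (\<Union>n. {g \<in> \<Gamma>. g ` cball 0 (real n) \<inter> cball 0 (real n) \<noteq> {}})"
    by (intro countable_UN countable_finite[OF proper[OF compact_cball]]) simp
  ultimately show ?thesis using countable_subset by blast
qed

lemma proper_orbit: "finite {g \<in> \<Gamma>. g v \<in> cball v r}"
proof -
  have "{g \<in> \<Gamma>. g v \<in> cball v r} \<subseteq> {g \<in> \<Gamma>. g ` cball v r \<inter> cball v r \<noteq> {}}"
  proof
    fix g assume g: "g \<in> {g \<in> \<Gamma>. g v \<in> cball v r}"
    then have "dist v (g v) \<le> r" by simp
    then have "0 \<le> r" using zero_le_dist order_trans by blast
    then have "v \<in> cball v r" by simp
    then show "g \<in> {g \<in> \<Gamma>. g ` cball v r \<inter> cball v r \<noteq> {}}" using g by blast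
  qed
  then show ?thesis using proper[OF compact_cball] finite_subset by blast
qed

text \<open>Closedness inside an open subset of the quotient is moved up to the vector space, where
  \<open>F\<close> is the full preimage of \<open>W\<close>.\<close>

lemma closed_locally_preimage:
  assumes W: "\<And>x. orbit \<Gamma> x \<in> W \<longleftrightarrow> x \<in> F"
    and U: "openin (orbit_topology \<Gamma>) U" "orbit \<Gamma> v \<in> U"
    and cl: "closedin (subtopology (orbit_topology \<Gamma>) U) (U \<inter> W)"
  shows "\<exists>N. open N \<and> v \<in> N \<and> open (N - F)"
proof -
  let ?N = "orbit \<Gamma> -` U"
  have "U \<subseteq> topspace (orbit_topology \<Gamma>)" using U(1) openin_subset by blast
  then have "topspace (subtopology (orbit_topology \<Gamma>) U) - (U \<inter> W) = U - W" by auto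
  then have "openin (subtopology (orbit_topology \<Gamma>) U) (U - W)"
    using cl by (metis closedin_def)
  then have "openin (orbit_topology \<Gamma>) (U - W)" using openin_open_subtopology[OF U(1)] by blast
  then have "open (orbit \<Gamma> -` (U - W))" using openin_orbit_topology by blast
  moreover have "orbit \<Gamma> -` (U - W) = ?N - F" using W by auto
  moreover have "open ?N" using U(1) openin_orbit_topology by blast
  ultimately show ?thesis using U(2) by (intro exI[of _ ?N]) auto
qed

lemma orbit_mem_image:
  "orbit \<Gamma> x \<in> orbit \<Gamma> ` S \<longleftrightarrow> x \<in> {g y |g y. g \<in> \<Gamma> \<and> y \<in> S}"
proof
  assume "orbit \<Gamma> x \<in> orbit \<Gamma> ` S"
  then obtain y where y: "y \<in> S" "orbit \<Gamma> x = orbit \<Gamma> y" by blast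
  then have "x \<in> orbit \<Gamma> y" using orbit_self[OF id_in] by metis
  then show "x \<in> {g y |g y. g \<in> \<Gamma> \<and> y \<in> S}" using y by (auto simp: orbit_def)
next
  assume "x \<in> {g y |g y. g \<in> \<Gamma> \<and> y \<in> S}"
  then show "orbit \<Gamma> x \<in> orbit \<Gamma> ` S" using orbit_image by auto
qed

text \<open>The sign \<open>s\<close> stands for the future (\<open>1\<close>) or the past
  (\<open>-1\<close>), so that later arguments are given once for both. The set removed from
  \<open>N\<close> is the full preimage of the future or past of the orbit of
  \<open>v\<close>.\<close>

lemma strictly_causal_closed:
  assumes "strictly_causal C \<Gamma>" "s \<in> {1, -1}"
  shows "\<exists>N. open N \<and> v \<in> N \<and> open (N - {g (v + s *\<^sub>R c) |g c. g \<in> \<Gamma> \<and> c \<in> C})"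
proof -
  obtain U where U: "openin (orbit_topology \<Gamma>) U" "orbit \<Gamma> v \<in> U"
    "closedin (subtopology (orbit_topology \<Gamma>) U) (U \<inter> future_of C \<Gamma> v)"
    "closedin (subtopology (orbit_topology \<Gamma>) U) (U \<inter> past_of C \<Gamma> v)"
    using assms(1) unfolding strictly_causal_def by blast
  have eq: "{g y |g y. g \<in> \<Gamma> \<and> y \<in> (\<lambda>c. v + s *\<^sub>R c) ` C} = {g (v + s *\<^sub>R c) |g c. g \<in> \<Gamma> \<and> c \<in> C}"
    by blast
  have "closedin (subtopology (orbit_topology \<Gamma>) U) (U \<inter> orbit \<Gamma> ` ((\<lambda>c. v + s *\<^sub>R c) ` C))"
    using assms(2) U(3,4) by (auto simp: future_of_def past_of_def)
  then show ?thesis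
    unfolding eq[symmetric] by (rule closed_locally_preimage[OF orbit_mem_image U(1,2)])
qed

end

subsection \<open>Lorentzian cones and their groups\<close>

text \<open>The timelike unit vector \<open>e\<close> supplies a height \<open>l v e\<close> and a
  negative definite complement; compactness and comparison arguments are all made relative to
  it.\<close>

locale lorentz_cone =
  fixes l :: "'a::euclidean_space \<Rightarrow> 'a \<Rightarrow> real" and C :: "'a set" and e :: 'a
  assumes bil: "bilinear l" and sym: "l x y = l y x"
    and tc: "time_cone l C"
    and e: "e \<in> C" "l e e = 1" and neg: "l w e = 0 \<Longrightarrow> w \<noteq> 0 \<Longrightarrow> l w w < 0"
begin

lemmas l_simps = bilinear_ladd[OF bil] bilinear_radd[OF bil] bilinear_lsub[OF bil] bilinear_rsub[OF bil]
  bilinear_lmul[OF bil] bilinear_rmul[OF bil] bilinear_lneg[OF bil] bilinear_rneg[OF bil]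
  bilinear_lzero[OF bil] bilinear_rzero[OF bil]

lemma continuous_on_l [continuous_intros]:
  "continuous_on S f \<Longrightarrow> continuous_on S g \<Longrightarrow> continuous_on S (\<lambda>x. l (f x) (g x))"
  by (rule bounded_bilinear.continuous_on[OF bil[unfolded bilinear_conv_bounded_bilinear]])

lemma tendsto_l:
  "(f \<longlongrightarrow> a) F \<Longrightarrow> (g \<longlongrightarrow> b) F \<Longrightarrow> ((\<lambda>x. l (f x) (g x)) \<longlongrightarrow> l a b) F"
  by (rule bounded_bilinear.tendsto[OF bil[unfolded bilinear_conv_bounded_bilinear]])

lemma C_add: "v \<in> C \<Longrightarrow> w \<in> C \<Longrightarrow> v + w \<in> C"
  using tc convex_cone[of C] unfolding time_cone_def by blast

lemma C_scale: "v \<in> C \<Longrightarrow> s \<ge> 0 \<Longrightarrow> s *\<^sub>R v \<in> C"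
  using tc unfolding time_cone_def cone_def by blast

lemma C_closed: "closed C"
  using tc unfolding time_cone_def by blast

lemma C_cases: "l v v \<ge> 0 \<Longrightarrow> v \<in> C \<or> - v \<in> C"
  using tc unfolding time_cone_def by force

lemma C_nonneg: "v \<in> C \<Longrightarrow> l v v \<ge> 0"
  using tc unfolding time_cone_def by blast

lemma C_pointed: "v \<in> C \<Longrightarrow> - v \<in> C \<Longrightarrow> v = 0"
proof -
  assume v: "v \<in> C" "- v \<in> C"
  have "v \<in> uminus ` C" using image_eqI[of v uminus "- v" C] v(2) by simp
  then show "v = 0" using v(1) tc unfolding time_cone_def by blast
qed

text \<open>If the height were not positive, adding a nonnegative multiple of \<open>e\<close> would
  move \<open>v\<close> within \<open>C\<close> to a vector orthogonal to \<open>e\<close>. There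
  \<open>l\<close> is negative definite, so this vector is \<open>0\<close>, and \<open>- v\<close>
  lies in \<open>C\<close> as well.\<close>

lemma height_pos:
  assumes "v \<in> C" "v \<noteq> 0"
  shows "l v e > 0"
proof (rule ccontr)
  assume n: "\<not> l v e > 0"
  define w where "w = v + (- l v e) *\<^sub>R e"
  have "w \<in> C" unfolding w_def using n assms e by (intro C_add C_scale) auto
  moreover have "l w e = 0" by (simp add: w_def l_simps e)
  ultimately have "w = 0" using neg[of w] C_nonneg[of w] by force
  then have "- v = (- l v e) *\<^sub>R e" by (simp add: w_def algebra_simps)
  then have "- v \<in> C" using n e C_scale by (metis le_minus_iff minus_zero not_less)
  then show False using C_pointed assms by blast
qed

text \<open>Both parts express that \<open>l w e *\<^sub>R v - l v e *\<^sub>R w\<close> is orthogonal to \<open>e\<close>, where \<open>l\<close> is negative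
  definite. They replace the reversed Cauchy-Schwarz inequality.\<close>

lemma comparison:
  "2 * (l v e * l w e) * l v w \<ge> (l w e)\<^sup>2 * l v v + (l v e)\<^sup>2 * l w w"
  "2 * (l v e * l w e) * l v w = (l w e)\<^sup>2 * l v v + (l v e)\<^sup>2 * l w w \<Longrightarrow> l w e *\<^sub>R v = l v e *\<^sub>R w"
proof -
  define x where "x = l w e *\<^sub>R v - l v e *\<^sub>R w"
  have x: "l x e = 0" by (simp add: x_def l_simps)
  have xx: "l x x = (l w e)\<^sup>2 * l v v + (l v e)\<^sup>2 * l w w - 2 * (l v e * l w e) * l v w"
    by (simp add: x_def l_simps power2_eq_square sym[of w v] algebra_simps)
  show "2 * (l v e * l w e) * l v w \<ge> (l w e)\<^sup>2 * l v v + (l v e)\<^sup>2 * l w w"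
    using neg[OF x] xx by (cases "x = 0") (auto simp: l_simps)
  show "l w e *\<^sub>R v = l v e *\<^sub>R w"
    if "2 * (l v e * l w e) * l v w = (l w e)\<^sup>2 * l v v + (l v e)\<^sup>2 * l w w"
    using neg[OF x] xx that by (cases "x = 0") (auto simp: x_def)
qed

lemma l_nonneg:
  assumes "v \<in> C" "w \<in> C"
  shows "l v w \<ge> 0"
proof (cases "v = 0 \<or> w = 0")
  case False
  then have p: "l v e * l w e > 0" using height_pos assms by simp
  have "(l w e)\<^sup>2 * l v v + (l v e)\<^sup>2 * l w w \<ge> 0" using C_nonneg assms by simp
  then have "(l v e * l w e) * l v w \<ge> 0" using comparison(1)[where v = v and w = w] by linarith
  then show ?thesis using p by (simp add: zero_le_mult_iff)
qed (auto simp: l_simps)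

text \<open>This is an equality case of \<open>comparison\<close>: its right-hand side is
  nonnegative on \<open>C\<close> and its left-hand side is \<open>0\<close>.\<close>

lemma null_parallel:
  assumes "v \<in> C" "w \<in> C" "l v w = 0"
  shows "l w e *\<^sub>R v = l v e *\<^sub>R w"
proof (rule comparison(2))
  have "(l w e)\<^sup>2 * l v v + (l v e)\<^sup>2 * l w w \<ge> 0" using C_nonneg assms by simp
  then show "2 * (l v e * l w e) * l v w = (l w e)\<^sup>2 * l v v + (l v e)\<^sup>2 * l w w"
    using comparison(1)[where v = v and w = w] assms(3) by simp
qed

text \<open>\<open>comparison\<close> first forces equal heights, since the sum of their squares is
  at most twice their product, and then holds with equality, so the vectors are parallel of equal
  height.\<close>

lemma reverse_Cauchy_Schwarz_eq:
  assumes "v \<in> C" "w \<in> C" "l v v = m" "l w w = m" "m > 0" "l v w \<le> m"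
  shows "v = w"
proof -
  note comparison = comparison[where v = v and w = w]
  have nz: "v \<noteq> 0" "w \<noteq> 0" using assms by (auto simp: l_simps)
  have p: "l v e > 0" "l w e > 0" using height_pos assms nz by auto
  have c: "2 * (l v e * l w e) * l v w \<ge> ((l w e)\<^sup>2 + (l v e)\<^sup>2) * m"
    using comparison(1) assms by (simp add: algebra_simps)
  have "2 * (l v e * l w e) * l v w \<le> 2 * (l v e * l w e) * m"
    using p assms(6) by (intro mult_left_mono) auto
  then have "((l w e)\<^sup>2 + (l v e)\<^sup>2) * m \<le> 2 * (l v e * l w e) * m" using c by linarith
  then have "(l w e)\<^sup>2 + (l v e)\<^sup>2 \<le> 2 * (l v e * l w e)" using assms(5) by simp
  then have "(l v e - l w e)\<^sup>2 \<le> 0" by (simp add: power2_diff algebra_simps)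
  then have eq: "l v e = l w e" by simp
  have "2 * (l v e * l w e) * l v w = (l w e)\<^sup>2 * l v v + (l v e)\<^sup>2 * l w w"
  proof (rule antisym)
    show "2 * (l v e * l w e) * l v w \<le> (l w e)\<^sup>2 * l v v + (l v e)\<^sup>2 * l w w"
      using mult_left_mono[OF assms(6), of "2 * (l w e * l w e)"]
      unfolding assms(3,4) eq by (simp add: power2_eq_square algebra_simps)
  qed (rule comparison(1))
  then have "l w e *\<^sub>R v = l v e *\<^sub>R w" by (rule comparison(2))
  then show ?thesis using eq p by simp
qed

text \<open>On the unit vectors of \<open>C\<close> the height is bounded below by some
  \<open>\<mu> > 0\<close>; by homogeneity a bound on the height bounds the norm.\<close>

lemma compact_slab: "compact {v \<in> C. l v e \<le> M}"
proof -
  have closed: "closed {v \<in> C. l v e \<le> M}"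
    unfolding Collect_conj_eq using C_closed
    by (auto intro!: closed_Int closed_Collect_le continuous_intros)
  define K where "K = C \<inter> sphere 0 1"
  have "compact K" unfolding K_def using C_closed by (simp add: closed_Int_compact)
  have "\<exists>\<mu>>0. \<forall>v\<in>K. l v e \<ge> \<mu>"
  proof (cases "K = {}")
    case False
    have "continuous_on K (\<lambda>v. l v e)" by (intro continuous_intros)
    then obtain x where x: "x \<in> K" "\<forall>v\<in>K. l x e \<le> l v e"
      using continuous_attains_inf[OF \<open>compact K\<close> False] by blast
    then have "l x e > 0" using height_pos[of x] by (fastforce simp: K_def)
    then show ?thesis using x by blast
  qed (auto intro: exI[of _ 1])
  then obtain \<mu> where \<mu>: "\<mu> > 0" "\<And>v. v \<in> K \<Longrightarrow> l v e \<ge> \<mu>" by blast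
  have "norm v \<le> \<bar>M\<bar> / \<mu>" if v: "v \<in> C" "l v e \<le> M" for v
  proof (cases "v = 0")
    case False
    have "(1 / norm v) *\<^sub>R v \<in> K" using v False by (simp add: K_def C_scale)
    then have "\<mu> \<le> l v e / norm v" using \<mu>(2) by (fastforce simp: l_simps)
    then have "\<mu> * norm v \<le> l v e" using False by (simp add: field_simps)
    then show ?thesis using v \<mu> by (simp add: field_simps)
  qed (use \<mu> in auto)
  then have "bounded {v \<in> C. l v e \<le> M}" by (auto intro: boundedI)
  then show ?thesis using closed compact_eq_bounded_closed by blast
qed

text \<open>The vectors with \<open>l v v > 0\<close> outside \<open>- C\<close> form an open set,
  and they all lie in \<open>C\<close>.\<close>

lemma timelike_interior:
  assumes "v \<in> C" "l v v > 0"
  shows "v \<in> interior C"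
proof (rule interiorI)
  have "open {v. l v v > 0}" by (intro open_Collect_less continuous_intros)
  then show "open ({v. l v v > 0} - uminus ` C)" using C_closed closed_negations by (intro open_Diff)
  have "x \<in> C" if "l x x > 0" "x \<notin> uminus ` C" for x
    using C_cases[of x] that by (metis image_eqI less_imp_le minus_minus)
  then show "{v. l v v > 0} - uminus ` C \<subseteq> C" by blast
  show "v \<in> {v. l v v > 0} - uminus ` C"
  proof -
    have "v \<noteq> 0" using assms by (auto simp: l_simps)
    then show ?thesis using assms C_pointed by auto
  qed
qed

end

section \<open>Linear isometry groups: bounded and unbounded orbits of \<open>e\<close>\<close>

locale lorentz_group = lorentz_cone l C e
  for l :: "'a::euclidean_space \<Rightarrow> 'a \<Rightarrow> real" and C e +
  fixes G :: "('a \<Rightarrow> 'a) set"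
  assumes id_in: "id \<in> G" and comp_in: "g \<in> G \<Longrightarrow> h \<in> G \<Longrightarrow> g \<circ> h \<in> G"
    and inv_in: "g \<in> G \<Longrightarrow> \<exists>h\<in>G. g \<circ> h = id \<and> h \<circ> g = id"
    and lin: "g \<in> G \<Longrightarrow> linear g" and isom: "g \<in> G \<Longrightarrow> l (g x) (g y) = l x y"
    and pres: "g \<in> G \<Longrightarrow> x \<in> C \<Longrightarrow> g x \<in> C"
    and no_timelike: "g \<in> G \<Longrightarrow> l (g w - w) (g w - w) \<le> 0"
begin

text \<open>The closed convex hull \<open>K\<close> of the orbit of \<open>e\<close> is compact and
  invariant. The maximum of \<open>l v v\<close> on \<open>K\<close> is at least
  \<open>l e e = 1\<close> and is attained at a single point of each orbit, so a maximizer is fixed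
  and timelike.\<close>

lemma bounded_fixed:
  assumes M: "\<And>g. g \<in> G \<Longrightarrow> l (g e) e \<le> M"
  shows "\<exists>v\<in>interior C. \<forall>g\<in>G. g v = v"
proof -
  define S where "S = (\<lambda>g. g e) ` G"
  define K where "K = closure (convex hull S)"
  have slab: "{v \<in> C. l v e \<le> M} = C \<inter> {v. l v e \<le> M}" by blast
  have "convex {v \<in> C. l v e \<le> M}"
    unfolding slab using tc unfolding time_cone_def
    by (intro convex_Int) (auto simp: convex_def l_simps intro!: convex_bound_le)
  moreover have "S \<subseteq> {v \<in> C. l v e \<le> M}" unfolding S_def using M pres e by auto
  ultimately have K: "K \<subseteq> {v \<in> C. l v e \<le> M}"
    unfolding K_def using compact_slab compact_imp_closed by (intro closure_minimal hull_minimal) auto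
  then have "compact K" unfolding K_def using compact_slab compact_closure bounded_subset compact_imp_bounded
    by (metis closure_subset)
  have "convex K" unfolding K_def by (intro convex_closure convex_convex_hull)
  have "S \<subseteq> K" unfolding K_def by (meson closure_subset hull_subset order_trans)
  moreover have "e \<in> S" unfolding S_def using image_eqI[of e "\<lambda>g. g e" id G] id_in by simp
  ultimately have "e \<in> K" by blast
  have inv: "g v \<in> K" if g: "g \<in> G" and v: "v \<in> K" for g v
  proof -
    have "g ` S \<subseteq> S"
    proof -
      have "g (h e) \<in> S" if "h \<in> G" for h
        unfolding S_def using image_eqI[OF _ comp_in[OF g that], of _ "\<lambda>g. g e"] by simp
      then show ?thesis unfolding S_def by blast
    qed
    then have "g ` (convex hull S) \<subseteq> convex hull S"
      using convex_hull_linear_image[OF lin[OF g]] hull_mono by metis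
    moreover have "g ` closure (convex hull S) \<subseteq> closure (g ` (convex hull S))"
      using lin[OF g] closure_linear_image_subset by blast
    ultimately show ?thesis using v closure_mono unfolding K_def by blast
  qed
  have "continuous_on K (\<lambda>v. l v v)" by (intro continuous_intros)
  then obtain x where x: "x \<in> K" "\<forall>v\<in>K. l v v \<le> l x x"
    using continuous_attains_sup[OF \<open>compact K\<close>] \<open>e \<in> K\<close> by blast
  have pos: "l x x > 0" using x(2) \<open>e \<in> K\<close> e(2) by force
  have "g x = x" if g: "g \<in> G" for g
  proof (rule reverse_Cauchy_Schwarz_eq)
    show "g x \<in> C" "x \<in> C" using inv[OF g x(1)] x(1) K by auto
    show "l (g x) (g x) = l x x" using isom[OF g] by simp
    \<comment> \<open>At the midpoint of \<open>x\<close> and \<open>g x\<close> the form takes the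
      value \<open>(l x x + l (g x) x) / 2\<close>, so maximality bounds \<open>l (g x) x\<close> by
      \<open>l x x\<close>.\<close>
    have "(1/2) *\<^sub>R g x + (1/2) *\<^sub>R x \<in> K"
      using \<open>convex K\<close> inv[OF g x(1)] x(1) by (simp add: convex_def)
    then have "l ((1/2) *\<^sub>R g x + (1/2) *\<^sub>R x) ((1/2) *\<^sub>R g x + (1/2) *\<^sub>R x) \<le> l x x" using x(2) by blast
    then show "l (g x) x \<le> l x x" using isom[OF g, of x x] by (simp add: l_simps sym[of x "g x"] field_simps)
  qed (use pos in auto)
  moreover have "x \<in> interior C" using timelike_interior[OF _ pos] x(1) K by blast
  ultimately show ?thesis by blast
qed

text \<open>\<open>no_timelike\<close> is used twice: first to show that every \<open>k\<close> maps
  the limit \<open>q\<close> into the line of \<open>p\<close>, which for \<open>k = id\<close>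
  gives \<open>q = p\<close>, and then to show that the factor by which \<open>k\<close> scales
  \<open>p\<close> is \<open>1\<close>.\<close>

lemma unbounded_fixed:
  assumes M: "\<And>M. \<exists>g\<in>G. l (g e) e > M"
  shows "\<exists>p\<in>C. l p e = 1 \<and> l p p = 0 \<and> (\<forall>g\<in>G. g p = p)"
proof -
  have "\<forall>n. \<exists>g. g \<in> G \<and> l (g e) e > real n + 1" using M by blast
  then obtain g where g: "\<And>n. g n \<in> G" "\<And>n. l (g n e) e > real n + 1" by metis
  have "\<forall>n. \<exists>h. h \<in> G \<and> g n \<circ> h = id \<and> h \<circ> g n = id" using inv_in g by blast
  then obtain h where h: "\<And>n. h n \<in> G" "\<And>n. g n \<circ> h n = id" "\<And>n. h n \<circ> g n = id" by metis
  have gh: "g n (h n v) = v" for n v using h(2) by (metis comp_apply id_apply)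
  define c where "c n = l (g n e) e" for n
  have c: "c n > real n + 1" for n using g by (simp add: c_def)
  have c0: "c n > 0" for n using c[of n] by linarith
  \<comment> \<open>An element and its inverse raise \<open>e\<close> to the same height, so one
    rescaling factor serves both sequences.\<close>
  have ch: "l (h n e) e = c n" for n
    using isom[OF g(1), of n "h n e" e] by (simp add: gh c_def sym)
  \<comment> \<open>Pairing the two sequences yields a common convergent subsequence.\<close>
  define P where "P n = (inverse (c n) *\<^sub>R g n e, inverse (c n) *\<^sub>R h n e)" for n
  define K where "K = {v \<in> C. l v e \<le> 1}"
  have "P n \<in> K \<times> K" for n
    using c0[of n] pres[OF g(1) e(1)] pres[OF h(1) e(1)]
    by (simp add: P_def K_def l_simps C_scale ch c_def[symmetric])
  moreover have "seq_compact (K \<times> K)"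
    unfolding K_def using compact_Times compact_slab compact_eq_seq_compact_metric by blast
  ultimately obtain pq r where r: "strict_mono r" "(P \<circ> r) \<longlonglongrightarrow> pq" "pq \<in> K \<times> K"
    unfolding seq_compact_def by metis
  obtain p q where pq: "pq = (p, q)" by fastforce
  have inC: "p \<in> C" "q \<in> C" using r(3) pq by (auto simp: K_def)
  have limp: "(\<lambda>n. inverse (c (r n)) *\<^sub>R g (r n) e) \<longlonglongrightarrow> p"
    using tendsto_fst[OF r(2)] by (simp add: P_def pq o_def)
  have limq: "(\<lambda>n. inverse (c (r n)) *\<^sub>R h (r n) e) \<longlonglongrightarrow> q"
    using tendsto_snd[OF r(2)] by (simp add: P_def pq o_def)
  have "real n \<le> c n" for n using c[of n] by linarith
  then have "filterlim c at_top sequentially"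
    by (intro filterlim_at_top_mono[OF filterlim_real_sequentially] always_eventually) blast
  then have lim0: "(\<lambda>n. inverse (c (r n))) \<longlonglongrightarrow> 0"
    by (intro tendsto_inverse_0_at_top filterlim_compose[OF _ filterlim_subseq[OF r(1)]])
  have height1: "l x e = 1" if "(\<lambda>n. inverse (c (r n)) *\<^sub>R f n) \<longlonglongrightarrow> x" "\<And>n. l (f n) e = c (r n)" for x f
  proof -
    have "(\<lambda>n. l (inverse (c (r n)) *\<^sub>R f n) e) \<longlonglongrightarrow> l x e" by (intro tendsto_l that tendsto_const)
    moreover have "l (inverse (c (r n)) *\<^sub>R f n) e = 1" for n
      using that(2) c0[of "r n"] by (simp add: l_simps)
    ultimately show ?thesis by (simp add: LIMSEQ_const_iff)
  qed
  have he: "l p e = 1" "l q e = 1" using height1[OF limp] height1[OF limq] by (auto simp: c_def[symmetric] ch)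
  have null: "l x x = 0" if x: "(\<lambda>n. inverse (c (r n)) *\<^sub>R f n) \<longlonglongrightarrow> x" "\<And>n. l (f n) (f n) = 1" for x f
  proof -
    have "(\<lambda>n. l (inverse (c (r n)) *\<^sub>R f n) (inverse (c (r n)) *\<^sub>R f n)) \<longlonglongrightarrow> l x x" by (intro tendsto_l x)
    then have "(\<lambda>n. inverse (c (r n)) * inverse (c (r n))) \<longlonglongrightarrow> l x x" by (simp add: l_simps x(2))
    moreover have "(\<lambda>n. inverse (c (r n)) * inverse (c (r n))) \<longlonglongrightarrow> 0 * 0" by (intro tendsto_mult lim0)
    ultimately show ?thesis using LIMSEQ_unique by force
  qed
  have pp: "l p p = 0" "l q q = 0"
    using null[OF limp] null[OF limq] isom[OF g(1)] isom[OF h(1)] e(2) by auto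
  have par: "k q = l (k q) e *\<^sub>R p" if k: "k \<in> G" for k
  proof -
    obtain k' where k': "k' \<in> G" "k \<circ> k' = id" "k' \<circ> k = id" using inv_in k by blast
    \<comment> \<open>This is \<open>?m ?w - ?w\<close> for the \<open>?m\<close> and
      \<open>?w\<close> below, chosen so that the two large terms \<open>g (r n) e\<close> and
      \<open>k (h (r n) e)\<close> enter with the same sign. In the limit
      \<open>l (p + k q) (p + k q) = 2 * l p (k q)\<close> cannot be positive.\<close>
    define x where "x n = (g (r n) e + k (h (r n) e)) - (k e + e)" for n
    have "l (x n) (x n) \<le> 0" for n
    proof -
      let ?m = "g (r n) \<circ> k'" and ?w = "k e - k (h (r n) e)"
      have kk: "k' (k v) = v" for v using k' by (metis comp_apply id_apply)
      have "?m ?w = g (r n) e - e"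
        using linear_diff[OF lin[OF k'(1)]] linear_diff[OF lin[OF g(1)]] by (simp add: kk gh)
      then have "?m ?w - ?w = x n" by (simp add: x_def)
      then show ?thesis using no_timelike[OF comp_in[OF g(1) k'(1)], of "r n" ?w] by simp
    qed
    then have le: "l (inverse (c (r n)) *\<^sub>R x n) (inverse (c (r n)) *\<^sub>R x n) \<le> 0" for n
      by (simp add: l_simps mult_nonneg_nonpos c0 less_imp_le)
    have kc: "(\<lambda>n. k (inverse (c (r n)) *\<^sub>R h (r n) e)) \<longlonglongrightarrow> k q"
      using linear_continuous_at[OF lin[OF k, unfolded linear_conv_bounded_linear]] limq
      by (auto intro: isCont_tendsto_compose)
    have "(\<lambda>n. (inverse (c (r n)) *\<^sub>R g (r n) e + k (inverse (c (r n)) *\<^sub>R h (r n) e))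
        - inverse (c (r n)) *\<^sub>R (k e + e)) \<longlonglongrightarrow> (p + k q) - 0 *\<^sub>R (k e + e)"
      by (intro tendsto_diff tendsto_add tendsto_scaleR limp kc lim0 tendsto_const)
    then have "(\<lambda>n. inverse (c (r n)) *\<^sub>R x n) \<longlonglongrightarrow> p + k q"
      by (simp add: x_def linear_scale[OF lin[OF k]] algebra_simps)
    then have "(\<lambda>n. l (inverse (c (r n)) *\<^sub>R x n) (inverse (c (r n)) *\<^sub>R x n)) \<longlonglongrightarrow> l (p + k q) (p + k q)"
      by (intro tendsto_l)
    then have "l (p + k q) (p + k q) \<le> 0" using le by (intro LIMSEQ_le_const2) auto
    then have "l p (k q) \<le> 0" using isom[OF k, of q q] pp by (simp add: l_simps sym[of "k q" p])
    then have "l p (k q) = 0" using l_nonneg[OF inC(1) pres[OF k inC(2)]] by simp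
    then show ?thesis using null_parallel[OF inC(1) pres[OF k inC(2)]] he by simp
  qed
  have "q = p" using par[OF id_in] he by simp
  have fixed: "k p = p" if k: "k \<in> G" for k
  proof -
    define s where "s = l (k p) e"
    have kp: "k p = s *\<^sub>R p" using par[OF k] \<open>q = p\<close> by (simp add: s_def)
    have "1 = l (k p) (k e)" using isom[OF k] he by simp
    then have s1: "s * l p (k e) = 1" by (simp add: kp l_simps)
    \<comment> \<open>Along the line \<open>T *\<^sub>R p + e\<close> the inequality is affine in
      \<open>T\<close>, because \<open>p\<close> is null. Being bounded above for all
      \<open>T\<close>, it has slope zero, and with \<open>s1\<close> this leaves only
      \<open>s = 1\<close>.\<close>
    have le: "2 * T * ((s - 1) * (l p (k e) - 1)) + l (k e - e) (k e - e) \<le> 0" for T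
    proof -
      have eq: "k (T *\<^sub>R p + e) - (T *\<^sub>R p + e) = (T * (s - 1)) *\<^sub>R p + (k e - e)"
        by (simp add: linear_add[OF lin[OF k]] linear_scale[OF lin[OF k]] kp algebra_simps)
      have "l ((T * (s - 1)) *\<^sub>R p + (k e - e)) ((T * (s - 1)) *\<^sub>R p + (k e - e)) \<le> 0"
        using no_timelike[OF k, of "T *\<^sub>R p + e"] unfolding eq .
      moreover have "l ((T * (s - 1)) *\<^sub>R p + (k e - e)) ((T * (s - 1)) *\<^sub>R p + (k e - e))
         = 2 * (T * (s - 1)) * l p (k e - e) + l (k e - e) (k e - e)"
        using sym[of p "k e - e"] pp(1)
        by (simp only: bilinear_ladd[OF bil] bilinear_radd[OF bil] bilinear_lmul[OF bil] bilinear_rmul[OF bil]) simp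
      ultimately show ?thesis by (simp add: l_simps he algebra_simps)
    qed
    have "z = 0" if "\<And>T. 2 * T * z + L \<le> 0" for z L :: real
      using that[of "(1 - L) / (2 * z)"] by (cases "z = 0") (auto simp: field_simps)
    from this[OF le] have "(s - 1) * (l p (k e) - 1) = 0" .
    then have "s = 1" using s1 by auto
    then show ?thesis using kp by simp
  qed
  show ?thesis using inC(1) he(1) pp(1) fixed by blast
qed

end

subsection \<open>Groups fixing a null vector\<close>

text \<open>The two components of the orthogonal group of the plane are
  \<open>z \<mapsto> \<epsilon> * z\<close> and \<open>z \<mapsto> \<epsilon> * cnj z\<close>; the
  flag puts both into one formula.\<close>

definition cnj_if :: "bool \<Rightarrow> complex \<Rightarrow> complex" where
  "cnj_if \<sigma> z = (if \<sigma> then cnj z else z)"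

lemma cnj_if_simps [simp]:
  "cnj_if False z = z" "cnj_if True z = cnj z"
  "cnj_if \<sigma> (z + w) = cnj_if \<sigma> z + cnj_if \<sigma> w"
  "cnj_if \<sigma> (z * w) = cnj_if \<sigma> z * cnj_if \<sigma> w"
  "cnj_if \<sigma> (complex_of_real r) = complex_of_real r"
  "cnj_if \<sigma> (cnj z) = cnj (cnj_if \<sigma> z)"
  "cnj_if \<sigma> 0 = 0" "cnj_if \<sigma> 1 = 1"
  "cnj_if \<sigma> (cnj_if \<tau> z) = cnj_if (\<sigma> \<noteq> \<tau>) z"
  "cmod (cnj_if \<sigma> z) = cmod z" "Re (cnj_if \<sigma> z) = Re z"
  by (auto simp: cnj_if_def)

lemma Re_real_mult: "Re (complex_of_real r * z) = r * Re z"
  by simp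

text \<open>With \<open>c\<close> and \<open>s\<close> the real and imaginary part of a rotation,
  the last two assumptions are one relation stated for the rotation with shift \<open>b\<close> and
  for its square with shift \<open>2 * b\<close>. Subtracting gives
  \<open>s\<^sup>2 * b = 0\<close>, and then \<open>s ^ 3 * y = 0\<close>.\<close>

lemma double_angle_rigidity:
  fixes c s y b :: real
  assumes "c\<^sup>2 + s\<^sup>2 = 1" "y \<noteq> 0" "- c * b = 2 * s * y" "- (c\<^sup>2 - s\<^sup>2) * (2 * b) = 2 * (2 * s * c) * y"
  shows "s = 0" "b = 0"
proof -
  have c0: "c \<noteq> 0" using assms by auto
  have "s ^ 3 * y = 0" using assms(3,4) by algebra
  then show "s = 0" using assms(2) by simp
  then show "b = 0" using assms(3) c0 by simp
qed

text \<open>The leading coefficient and the constant term have opposite signs, so the discriminant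
  is a sum of squares.\<close>

lemma quadratic_real_root:
  fixes q r y :: real
  shows "\<exists>T. q * T\<^sup>2 + r * T - y\<^sup>2 * q = 0"
proof (cases "q = 0")
  case False
  define D where "D = r\<^sup>2 + 4 * q\<^sup>2 * y\<^sup>2"
  have "(sqrt D)\<^sup>2 = D" by (simp add: D_def)
  then show ?thesis using False
    by (intro exI[of _ "(sqrt D - r) / (2 * q)"])
      (simp add: D_def field_simps power2_eq_square)
qed (auto intro: exI[of _ 0])

text \<open>The gap makes the infimum of the positive elements a minimum \<open>r\<close>, and
  division with remainder by \<open>r\<close> leaves no remainder.\<close>

lemma discrete_subgroup_real:
  fixes S :: "real set"
  assumes diff: "\<And>x y. x \<in> S \<Longrightarrow> y \<in> S \<Longrightarrow> x - y \<in> S"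
    and gap: "\<delta> > 0" "\<And>x. x \<in> S \<Longrightarrow> x \<noteq> 0 \<Longrightarrow> \<delta> \<le> \<bar>x\<bar>"
    and s: "s \<in> S" "s > 0"
  shows "\<exists>r>0. S = range (\<lambda>n. of_int n * r)"
proof -
  define P where "P = {x \<in> S. x > 0}"
  define r where "r = Inf P"
  have P: "P \<noteq> {}" "bdd_below P" using s by (auto simp: P_def intro: bdd_belowI[of _ 0])
  have rd: "\<delta> \<le> r" unfolding r_def using P gap(2) by (intro cInf_greatest) (force simp: P_def)+
  obtain x where x: "x \<in> P" "x < r + \<delta>" using cInf_lessD[OF P(1), of "r + \<delta>"] gap(1) by (auto simp: r_def)
  have "x = r"
  proof (rule ccontr)
    assume "x \<noteq> r"
    moreover have "r \<le> x" unfolding r_def using x P by (intro cInf_lower)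
    ultimately have "r < x" by simp
    then obtain y where y: "y \<in> P" "y < x" using cInf_lessD[OF P(1), of x] by (auto simp: r_def)
    have "r \<le> y" unfolding r_def using y P by (intro cInf_lower)
    then show False using gap(2)[OF diff, of x y] x y by (auto simp: P_def)
  qed
  then have r: "r \<in> S" "r > 0" using x by (auto simp: P_def)
  have mult: "of_int n * r \<in> S" for n
  proof (induction n rule: int_induct[where k = 0])
    case base
    show ?case using diff[OF r(1) r(1)] by simp
  next
    case (step1 i)
    have "- r \<in> S" using diff[OF diff[OF r(1) r(1)] r(1)] by simp
    then show ?case using diff[OF step1(2), of "- r"] by (simp add: algebra_simps)
  next
    case (step2 i)
    then show ?case using diff[OF step2(2) r(1)] by (simp add: algebra_simps)
  qed
  have "x \<in> range (\<lambda>n. of_int n * r)" if x: "x \<in> S" for x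
  proof -
    define y where "y = x - of_int \<lfloor>x / r\<rfloor> * r"
    have "y \<in> S" using diff[OF x mult] by (simp add: y_def)
    have "0 \<le> y" "y < r"
      using floor_divide_lower[OF r(2), of x] floor_divide_upper[OF r(2), of x]
      by (simp_all add: y_def algebra_simps)
    have "y = 0"
    proof (rule ccontr)
      assume "y \<noteq> 0"
      then have "y \<in> P" using \<open>0 \<le> y\<close> \<open>y \<in> S\<close> by (simp add: P_def)
      then have "r \<le> y" unfolding r_def using P by (intro cInf_lower)
      then show False using \<open>y < r\<close> by simp
    qed
    then show ?thesis by (auto simp: y_def)
  qed
  then show ?thesis using r(2) mult by blast
qed

section \<open>Null coordinates and the affine isometries fixing a null direction\<close>

locale null_frame =
  fixes z0 z3 :: "'a::euclidean_space \<Rightarrow> real" and zc :: "'a \<Rightarrow> complex"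
    and pt :: "real \<Rightarrow> complex \<Rightarrow> real \<Rightarrow> 'a"
  assumes lin0: "linear z0" and lin3: "linear z3" and linc: "linear zc"
    and pt_simps [simp]: "z0 (pt x z t) = x" "zc (pt x z t) = z" "z3 (pt x z t) = t"
    and pt_coords [simp]: "pt (z0 v) (zc v) (z3 v) = v"
begin

definition Q :: "'a \<Rightarrow> real" where
  "Q v = 2 * z0 v * z3 v - (cmod (zc v))\<^sup>2"

text \<open>These are the affine isometries of \<open>Q\<close> whose linear part fixes \<open>pt 1 0 0\<close>; the constant term
  \<open>c\<close> of \<open>z0\<close> is left implicit because it has no influence on the other coordinates.\<close>

definition frame_map :: "bool \<Rightarrow> complex \<Rightarrow> complex \<Rightarrow> complex \<Rightarrow> real \<Rightarrow> ('a \<Rightarrow> 'a) \<Rightarrow> bool" where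
  "frame_map \<sigma> \<epsilon> u a b g \<longleftrightarrow> cmod \<epsilon> = 1 \<and> (\<exists>c. \<forall>v.
     zc (g v) = \<epsilon> * cnj_if \<sigma> (zc v) + u * z3 v + a \<and>
     z3 (g v) = z3 v + b \<and>
     z0 (g v) = z0 v + Re (cnj u * \<epsilon> * cnj_if \<sigma> (zc v)) + (cmod u)\<^sup>2 / 2 * z3 v + c)"

lemma coords_eqI: "z0 v = z0 w \<Longrightarrow> zc v = zc w \<Longrightarrow> z3 v = z3 w \<Longrightarrow> v = w"
  by (metis pt_coords)

lemma coords_diff: "z0 (v - w) = z0 v - z0 w" "zc (v - w) = zc v - zc w" "z3 (v - w) = z3 v - z3 w"
  by (auto simp: lin0 lin3 linc linear_diff)

lemma coords_add: "z0 (v + w) = z0 v + z0 w" "zc (v + w) = zc v + zc w" "z3 (v + w) = z3 v + z3 w"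
  by (auto simp: lin0 lin3 linc linear_add)

lemma coords_scale: "z0 (r *\<^sub>R w) = r * z0 w" "zc (r *\<^sub>R w) = r *\<^sub>R zc w" "z3 (r *\<^sub>R w) = r * z3 w"
  by (auto simp: lin0 lin3 linc linear_scale)

lemma frame_map_id: "frame_map False 1 0 0 0 id"
  by (auto simp: frame_map_def)

text \<open>The parameters compose as in a semidirect product; the extra term \<open>u * b'\<close>
  comes from the shift of \<open>z3\<close>. The identities \<open>r1\<close> and \<open>r2\<close>
  show that the \<open>z0\<close> row keeps the shape prescribed by \<open>u\<close>.\<close>

lemma frame_map_comp:
  assumes "frame_map \<sigma> \<epsilon> u a b g" "frame_map \<tau> \<eta> w d b' h"
  shows "frame_map (\<sigma> \<noteq> \<tau>) (\<epsilon> * cnj_if \<sigma> \<eta>) (\<epsilon> * cnj_if \<sigma> w + u)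
           (\<epsilon> * cnj_if \<sigma> d + u * b' + a) (b + b') (g \<circ> h)"
proof -
  obtain c where c: "zc (g v) = \<epsilon> * cnj_if \<sigma> (zc v) + u * z3 v + a"
     "z3 (g v) = z3 v + b"
     "z0 (g v) = z0 v + Re (cnj u * \<epsilon> * cnj_if \<sigma> (zc v)) + (cmod u)\<^sup>2 / 2 * z3 v + c" for v
    using assms(1) unfolding frame_map_def by blast
  obtain c' where c': "zc (h v) = \<eta> * cnj_if \<tau> (zc v) + w * z3 v + d"
     "z3 (h v) = z3 v + b'"
     "z0 (h v) = z0 v + Re (cnj w * \<eta> * cnj_if \<tau> (zc v)) + (cmod w)\<^sup>2 / 2 * z3 v + c'" for v
    using assms(2) unfolding frame_map_def by blast
  have e: "cmod \<epsilon> = 1" "cmod \<eta> = 1" using assms by (auto simp: frame_map_def)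
  have ee: "cnj \<epsilon> * \<epsilon> = 1"
    using complex_norm_square[of \<epsilon>] e(1) by (simp add: mult.commute)
  have r1: "Re (cnj (\<epsilon> * cnj_if \<sigma> w + u) * (\<epsilon> * cnj_if \<sigma> \<eta>) * cnj_if (\<sigma> \<noteq> \<tau>) z)
      = Re (cnj w * \<eta> * cnj_if \<tau> z) + Re (cnj u * \<epsilon> * cnj_if \<sigma> (\<eta> * cnj_if \<tau> z))" for z
  proof -
    have "cnj (\<epsilon> * cnj_if \<sigma> w + u) * (\<epsilon> * cnj_if \<sigma> \<eta>) * cnj_if (\<sigma> \<noteq> \<tau>) z
      = (cnj \<epsilon> * \<epsilon>) * cnj_if \<sigma> (cnj w * \<eta> * cnj_if \<tau> z) + cnj u * \<epsilon> * cnj_if \<sigma> (\<eta> * cnj_if \<tau> z)"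
      by (simp add: algebra_simps)
    then show ?thesis unfolding ee by (simp del: cnj_if_simps(4))
  qed
  have r2: "(cmod (\<epsilon> * cnj_if \<sigma> w + u))\<^sup>2 / 2
      = (cmod w)\<^sup>2 / 2 + (cmod u)\<^sup>2 / 2 + Re (cnj u * \<epsilon> * cnj_if \<sigma> w)"
  proof -
    have "(cmod (x + u))\<^sup>2 / 2 = (cmod x)\<^sup>2 / 2 + (cmod u)\<^sup>2 / 2 + Re (cnj u * x)" for x
      unfolding cmod_power2 by (simp add: power2_eq_square field_simps)
    moreover have "cmod (\<epsilon> * cnj_if \<sigma> w) = cmod w" by (simp add: norm_mult e)
    ultimately show ?thesis by (metis mult.assoc)
  qed
  show ?thesis unfolding frame_map_def
  proof (intro conjI exI allI)
    fix v
    show "cmod (\<epsilon> * cnj_if \<sigma> \<eta>) = 1" by (simp add: norm_mult e)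
    show "z3 ((g \<circ> h) v) = z3 v + (b + b')" by (simp add: c c')
    show "zc ((g \<circ> h) v) = \<epsilon> * cnj_if \<sigma> \<eta> * cnj_if (\<sigma> \<noteq> \<tau>) (zc v) +
             (\<epsilon> * cnj_if \<sigma> w + u) * z3 v + (\<epsilon> * cnj_if \<sigma> d + u * b' + a)"
      by (simp add: c c' algebra_simps)
    show "z0 ((g \<circ> h) v) = z0 v +
         Re (cnj (\<epsilon> * cnj_if \<sigma> w + u) * (\<epsilon> * cnj_if \<sigma> \<eta>) * cnj_if (\<sigma> \<noteq> \<tau>) (zc v)) +
         (cmod (\<epsilon> * cnj_if \<sigma> w + u))\<^sup>2 / 2 * z3 v +
         (c + c' + (cmod u)\<^sup>2 / 2 * b' + Re (cnj u * \<epsilon> * cnj_if \<sigma> d))"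
      unfolding r1 r2
      by (simp add: c c' algebra_simps)
  qed
qed

lemma Q_frame_map:
  assumes "frame_map \<sigma> \<epsilon> u a b g"
  shows "Q (g v - g w) = Q (v - w)"
proof -
  obtain c where c: "zc (g v) = \<epsilon> * cnj_if \<sigma> (zc v) + u * z3 v + a"
     "z3 (g v) = z3 v + b"
     "z0 (g v) = z0 v + Re (cnj u * \<epsilon> * cnj_if \<sigma> (zc v)) + (cmod u)\<^sup>2 / 2 * z3 v + c" for v
    using assms(1) unfolding frame_map_def by blast
  have sub: "cnj_if \<sigma> x - cnj_if \<sigma> y = cnj_if \<sigma> (x - y)" for x y by (simp add: cnj_if_def)
  define z where "z = zc v - zc w"
  define t where "t = z3 v - z3 w"
  define y where "y = \<epsilon> * cnj_if \<sigma> z"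
  have y: "cmod y = cmod z" using assms by (simp add: y_def norm_mult frame_map_def)
  have 1: "zc (g v) - zc (g w) = y + u * t"
    unfolding c y_def z_def t_def by (simp add: sub[symmetric] algebra_simps)
  have 2: "z0 (g v) - z0 (g w) = z0 v - z0 w + Re (cnj u * y) + (cmod u)\<^sup>2 / 2 * t"
    unfolding c y_def z_def t_def by (simp add: sub[symmetric] field_simps)
  have 3: "z3 (g v) - z3 (g w) = t" by (simp add: c t_def)
  have "(cmod (y + u * t))\<^sup>2 = (cmod y)\<^sup>2 + 2 * Re (cnj u * y) * t + (cmod u)\<^sup>2 * t\<^sup>2"
    unfolding cmod_power2 by (simp add: power2_eq_square algebra_simps)
  then show ?thesis
    unfolding Q_def coords_diff 1 2 3 z_def[symmetric] t_def[symmetric] using y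
    by (simp add: power2_eq_square algebra_simps)
qed

lemma pt_expand:
  "pt x z t = x *\<^sub>R pt 1 0 0 + Re z *\<^sub>R pt 0 1 0 + Im z *\<^sub>R pt 0 \<i> 0 + t *\<^sub>R pt 0 0 1"
  by (rule coords_eqI) (simp_all add: coords_add coords_scale complex_eq_iff)

text \<open>The parameters can be read off at a few points. Identities between maps thereby become
  identities between parameters.\<close>

lemma frame_map_unique:
  assumes "frame_map \<sigma> \<epsilon> u a b g" "frame_map \<tau> \<eta> w d b' g"
  shows "\<sigma> = \<tau>" "\<epsilon> = \<eta>" "u = w" "a = d" "b = b'"
proof -
  have c: "zc (g v) = \<epsilon> * cnj_if \<sigma> (zc v) + u * z3 v + a" "z3 (g v) = z3 v + b"
    and c': "zc (g v) = \<eta> * cnj_if \<tau> (zc v) + w * z3 v + d" "z3 (g v) = z3 v + b'" for v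
    using assms unfolding frame_map_def by blast+
  have e: "\<epsilon> \<noteq> 0" using assms by (auto simp: frame_map_def)
  have *: "\<epsilon> * cnj_if \<sigma> z + u * t + a = \<eta> * cnj_if \<tau> z + w * t + d" for z and t :: real
    using c(1)[of "pt 0 z t"] c'(1)[of "pt 0 z t"] by simp
  show "a = d" using *[of 0 0] by simp
  then show "u = w" using *[of 0 1] by simp
  show eq: "\<epsilon> = \<eta>" using *[of 1 0] \<open>a = d\<close> by simp
  show "\<sigma> = \<tau>" using *[of \<i> 0] \<open>a = d\<close> eq e by (auto simp: cnj_if_def split: if_splits)
  show "b = b'" using c(2)[of 0] c'(2)[of 0] by simp
qed

end

section \<open>Restrictions imposed by causality and strict causality\<close>

locale null_frame_group = null_frame +
  fixes \<Gamma> :: "('a \<Rightarrow> 'a) set" and C :: "'a set"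
  assumes id_in: "id \<in> \<Gamma>"
    and comp_in: "g \<in> \<Gamma> \<Longrightarrow> h \<in> \<Gamma> \<Longrightarrow> g \<circ> h \<in> \<Gamma>"
    and inv_in: "g \<in> \<Gamma> \<Longrightarrow> \<exists>h\<in>\<Gamma>. g \<circ> h = id \<and> h \<circ> g = id"
    and frame_map_ex: "g \<in> \<Gamma> \<Longrightarrow> \<exists>\<sigma> \<epsilon> u a b. frame_map \<sigma> \<epsilon> u a b g"
    and spacelike: "g \<in> \<Gamma> \<Longrightarrow> h \<in> \<Gamma> \<Longrightarrow> g \<noteq> h \<Longrightarrow> Q (g v - h v) < 0"
    and unbounded: "\<exists>g\<in>\<Gamma>. \<exists>\<sigma> \<epsilon> u a b. frame_map \<sigma> \<epsilon> u a b g \<and> cmod u > M"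
    and proper: "finite {g \<in> \<Gamma>. g v \<in> cball v r}"
    and countable: "countable \<Gamma>"
    and cone_memI: "z3 v > 0 \<Longrightarrow> Q v \<ge> 0 \<Longrightarrow> v \<in> C"
    and cone_memD: "v \<in> C \<Longrightarrow> Q v \<ge> 0"
    and strict: "s \<in> {1, -1} \<Longrightarrow>
      \<exists>N. open N \<and> v \<in> N \<and> open (N - {g (v + s *\<^sub>R c) |g c. g \<in> \<Gamma> \<and> c \<in> C})"
begin

text \<open>The factor \<open>m\<close> is \<open>g\<close> composed with the inverse of
  \<open>h\<close>. Commutators and conjugates are obtained below as such quotients, for instance of
  \<open>g \<circ> h\<close> by \<open>h \<circ> g\<close> or by \<open>g\<close>, which avoids
  formulas for inverses.\<close>

lemma frame_map_quotient:
  assumes "g \<in> \<Gamma>" "h \<in> \<Gamma>" "frame_map \<sigma> \<epsilon> u a b g" "frame_map \<sigma> \<epsilon> w d b' h"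
  shows "\<exists>m\<in>\<Gamma>. g = m \<circ> h \<and> frame_map False 1 (u - w) (a - d - (u - w) * b') (b - b') m"
proof -
  obtain k where k: "k \<in> \<Gamma>" "h \<circ> k = id" "k \<circ> h = id" using inv_in assms by blast
  let ?m = "g \<circ> k"
  have m: "?m \<in> \<Gamma>" "g = ?m \<circ> h" using k assms comp_in by (auto simp: o_assoc[symmetric])
  obtain \<tau> \<eta> x y z where f: "frame_map \<tau> \<eta> x y z ?m" using frame_map_ex m by blast
  have gg: "frame_map (\<tau> \<noteq> \<sigma>) (\<eta> * cnj_if \<tau> \<epsilon>) (\<eta> * cnj_if \<tau> w + x)
           (\<eta> * cnj_if \<tau> d + x * b' + y) (z + b') g"
    using frame_map_comp[OF f assms(4)] m(2) by simp
  note u = frame_map_unique[OF gg assms(3)]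
  have t: "\<tau> = False" using u(1) by auto
  have e: "\<epsilon> \<noteq> 0" using assms(3) by (auto simp: frame_map_def)
  have "\<eta> = 1" using u(2) e t by simp
  moreover have "x = u - w" using u(3) t \<open>\<eta> = 1\<close> by (simp add: algebra_simps)
  moreover have "y = a - d - (u - w) * b'" using u(4) t \<open>\<eta> = 1\<close> \<open>x = u - w\<close> by (simp add: algebra_simps)
  moreover have "z = b - b'" using u(5) by simp
  ultimately show ?thesis using m f t by blast
qed

lemma eqI_Q: "g \<in> \<Gamma> \<Longrightarrow> h \<in> \<Gamma> \<Longrightarrow> Q (g v - h v) \<ge> 0 \<Longrightarrow> g = h"
  using spacelike[of g h v] by force

text \<open>Otherwise \<open>u\<close> is determined by the rotation part. Comparing
  \<open>g \<circ> h\<close> with \<open>h \<circ> g\<close> for one nontrivial rotation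
  \<open>g\<close> then bounds \<open>u\<close> on the orientation preserving elements; if there is
  no such rotation, \<open>u\<close> vanishes on them.\<close>

lemma ex_parabolic: "\<exists>g\<in>\<Gamma>. \<exists>u a b. frame_map False 1 u a b g \<and> u \<noteq> 0"
proof (rule ccontr)
  assume "\<not> ?thesis"
  then have n: "u = 0" if "g \<in> \<Gamma>" "frame_map False 1 u a b g" for g u a b using that by blast
  have same: "u = w" if "g \<in> \<Gamma>" "h \<in> \<Gamma>" "frame_map \<sigma> \<epsilon> u a b g" "frame_map \<sigma> \<epsilon> w d b' h"
    for g h \<sigma> \<epsilon> u a b w d b'
    using frame_map_quotient[OF that] n by force
  have "\<exists>B. \<forall>h w \<eta> d b. h \<in> \<Gamma> \<longrightarrow> frame_map False \<eta> w d b h \<longrightarrow> cmod w \<le> B"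
  proof (cases "\<exists>g\<in>\<Gamma>. \<exists>\<epsilon> u a b. frame_map False \<epsilon> u a b g \<and> \<epsilon> \<noteq> 1")
    case True
    then obtain g \<epsilon> u a b where g: "g \<in> \<Gamma>" "frame_map False \<epsilon> u a b g" "\<epsilon> \<noteq> 1" by blast
    have "cmod w \<le> 2 * cmod u / cmod (\<epsilon> - 1)" if h: "h \<in> \<Gamma>" "frame_map False \<eta> w d b' h" for h w \<eta> d b'
    proof -
      have "\<epsilon> * w + u = \<eta> * u + w"
        using same[OF comp_in[OF g(1) h(1)] comp_in[OF h(1) g(1)], of False "\<epsilon> * \<eta>"]
          frame_map_comp[OF g(2) h(2)] frame_map_comp[OF h(2) g(2)] by (auto simp: mult.commute)
      then have "(\<epsilon> - 1) * w = (\<eta> - 1) * u" by (simp add: algebra_simps)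
      then have "cmod (\<epsilon> - 1) * cmod w = cmod (\<eta> - 1) * cmod u" by (metis norm_mult)
      also have "\<dots> \<le> 2 * cmod u"
        using norm_triangle_ineq4[of \<eta> 1] h(2) by (intro mult_right_mono) (auto simp: frame_map_def)
      finally show ?thesis using g(3) by (simp add: field_simps)
    qed
    then show ?thesis by blast
  next
    case False
    then show ?thesis using n by (intro exI[of _ 0]) fastforce
  qed
  then obtain B where B: "cmod w \<le> B" if "h \<in> \<Gamma>" "frame_map False \<eta> w d b h" for h w \<eta> d b by blast
  \<comment> \<open>Composition with one fixed reflection reduces the orientation reversing elements
    to the bound \<open>B\<close>.\<close>
  have "\<exists>B'. \<forall>h w \<eta> d b. h \<in> \<Gamma> \<longrightarrow> frame_map True \<eta> w d b h \<longrightarrow> cmod w \<le> B'"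
  proof (cases "\<exists>g\<in>\<Gamma>. \<exists>\<epsilon> u a b. frame_map True \<epsilon> u a b g")
    case True
    then obtain g \<epsilon> u a b where g: "g \<in> \<Gamma>" "frame_map True \<epsilon> u a b g" by blast
    have "cmod w \<le> B + cmod u" if h: "h \<in> \<Gamma>" "frame_map True \<eta> w d b' h" for h w \<eta> d b'
    proof -
      have "cmod (\<epsilon> * cnj w + u) \<le> B"
        using B[OF comp_in[OF g(1) h(1)]] frame_map_comp[OF g(2) h(2)] by auto
      moreover have "cmod (\<epsilon> * cnj w) = cmod w" using g(2) by (simp add: norm_mult frame_map_def)
      ultimately show ?thesis using norm_triangle_ineq4[of "\<epsilon> * cnj w + u" u] by simp
    qed
    then show ?thesis by blast
  qed blast
  then obtain B' where B': "cmod w \<le> B'" if "h \<in> \<Gamma>" "frame_map True \<eta> w d b h" for h w \<eta> d b by blast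
  obtain g \<sigma> \<epsilon> u a b where g: "g \<in> \<Gamma>" "frame_map \<sigma> \<epsilon> u a b g" "cmod u > max B B'"
    using unbounded by blast
  then show False using B B' by (cases \<sigma>) fastforce+
qed

text \<open>The images of \<open>0\<close> under \<open>g \<circ> h\<close> and
  \<open>h \<circ> g\<close> differ at most in \<open>z0\<close>, hence by a null vector, so
  acausality makes the two maps equal. Comparing \<open>z0\<close> at the origin gives the
  symplectic relation.\<close>

lemma commuting:
  assumes "g \<in> \<Gamma>" "h \<in> \<Gamma>" "frame_map False 1 u a 0 g" "frame_map False 1 w d 0 h"
  shows "Re (cnj u * d) = Re (cnj w * a)"
proof -
  obtain c where c: "zc (g v) = zc v + u * z3 v + a"
     "z3 (g v) = z3 v"
     "z0 (g v) = z0 v + Re (cnj u * zc v) + (cmod u)\<^sup>2 / 2 * z3 v + c" for v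
    using assms(3) unfolding frame_map_def by auto
  obtain c' where c': "zc (h v) = zc v + w * z3 v + d"
     "z3 (h v) = z3 v"
     "z0 (h v) = z0 v + Re (cnj w * zc v) + (cmod w)\<^sup>2 / 2 * z3 v + c'" for v
    using assms(4) unfolding frame_map_def by auto
  have "Q ((g \<circ> h) 0 - (h \<circ> g) 0) = 0"
    by (simp add: Q_def coords_diff c c' linear_0 lin0 lin3 linc)
  then have "g \<circ> h = h \<circ> g" using eqI_Q comp_in assms(1,2) by (metis order_refl)
  then have "z0 (g (h 0)) = z0 (h (g 0))" by (metis comp_apply)
  then show ?thesis by (simp add: c c' linear_0 lin0 lin3 linc)
qed

text \<open>If \<open>b \<noteq> 0\<close>, the point can be moved in direction \<open>u\<close>
  until its displacement is null, which acausality forbids.\<close>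

lemma parabolic_b0:
  assumes "g \<in> \<Gamma>" "frame_map False 1 u a b g" "u \<noteq> 0"
  shows "b = 0"
proof (rule ccontr)
  assume b: "b \<noteq> 0"
  obtain c where c: "zc (g v) = zc v + u * z3 v + a"
     "z3 (g v) = z3 v + b"
     "z0 (g v) = z0 v + Re (cnj u * zc v) + (cmod u)\<^sup>2 / 2 * z3 v + c" for v
    using assms(2) unfolding frame_map_def by auto
  \<comment> \<open>This \<open>m\<close> solves
    \<open>2 * (m * (cmod u)\<^sup>2 + c) * b = (cmod a)\<^sup>2\<close>.\<close>
  define m where "m = ((cmod a)\<^sup>2 / (2 * b) - c) / (cmod u)\<^sup>2"
  have r: "Re (cnj u * (of_real m * u)) = m * (cmod u)\<^sup>2"
    unfolding cmod_power2 by (simp add: power2_eq_square algebra_simps)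
  have "Q (g (pt 0 (m * u) 0) - id (pt 0 (m * u) 0)) = 2 * (m * (cmod u)\<^sup>2 + c) * b - (cmod a)\<^sup>2"
    unfolding r[symmetric] by (simp add: Q_def coords_diff c)
  also have "\<dots> = 0" using b assms(3) by (simp add: m_def)
  finally have "g = id" using eqI_Q assms(1) id_in by (metis order_refl)
  then show False using frame_map_unique(5)[OF assms(2)] frame_map_id b by blast
qed

text \<open>In the case \<open>u = 0\<close>, the commutator with a parabolic \<open>h\<close> has
  parameters \<open>0\<close> and \<open>w * b\<close>, and its symplectic relation with
  \<open>h\<close> reads \<open>(cmod w)\<^sup>2 * b = 0\<close>.\<close>

lemma unipotent_b0:
  assumes g: "g \<in> \<Gamma>" "frame_map False 1 u a b g"
  shows "b = 0"
proof (cases "u = 0")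
  case True
  obtain h w d b' where h: "h \<in> \<Gamma>" "frame_map False 1 w d b' h" "w \<noteq> 0" using ex_parabolic by blast
  then have [simp]: "b' = 0" using parabolic_b0 by blast
  have "\<exists>m\<in>\<Gamma>. frame_map False 1 0 (w * b) 0 m"
    using frame_map_quotient[OF comp_in[OF h(1) g(1)] comp_in[OF g(1) h(1)], of False 1]
      frame_map_comp[OF h(2) g(2)] frame_map_comp[OF g(2) h(2)] True by fastforce
  then obtain m where m: "m \<in> \<Gamma>" "frame_map False 1 0 (w * b) 0 m" by blast
  have "Re (cnj w * (w * b)) = 0" using commuting[OF h(1) m(1) _ m(2)] h(2) by simp
  then have "(cmod w)\<^sup>2 * b = 0" unfolding cmod_power2 by (simp add: power2_eq_square algebra_simps)
  then show ?thesis using h(3) by simp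
qed (use assms parabolic_b0 in blast)

text \<open>On the level \<open>z3 = t\<close> the element translates the plane by
  \<open>u * t + a\<close>; if this were \<open>0\<close>, the displacement would be a multiple of
  the null vector.\<close>

lemma unipotent_nonvanishing:
  assumes "g \<in> \<Gamma>" "frame_map False 1 u a 0 g" "g \<noteq> id"
  shows "u * of_real t + a \<noteq> 0"
proof
  assume *: "u * of_real t + a = 0"
  have c: "zc (g v) = zc v + u * z3 v + a" "z3 (g v) = z3 v" for v
    using assms(2) unfolding frame_map_def by auto
  have "Q (g (pt 0 0 t) - id (pt 0 0 t)) = 0" using * by (simp add: Q_def coords_diff c)
  then show False using eqI_Q assms id_in by (metis order_refl)
qed

text \<open>Conjugating a parabolic \<open>h\<close> by \<open>g\<close> gives an element related to
  \<open>h\<close> by \<open>commuting\<close>. The resulting relation, for \<open>g\<close> and for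
  \<open>g \<circ> g\<close>, leaves only \<open>b = 0\<close> and \<open>\<epsilon> = 1\<close> or
  \<open>\<epsilon> = -1\<close>; a half-turn has a fixed point in the plane.\<close>

lemma rotation_trivial:
  assumes g: "g \<in> \<Gamma>" "frame_map False \<epsilon> u a b g"
  shows "\<epsilon> = 1" "b = 0"
proof -
  obtain h w d b' where h: "h \<in> \<Gamma>" "frame_map False 1 w d b' h" "w \<noteq> 0" using ex_parabolic by blast
  then have [simp]: "b' = 0" using unipotent_b0 by blast
  have hid: "h \<noteq> id" using h frame_map_unique(3) frame_map_id by blast
  define k where "k = d / w"
  have d: "d = k * w" using h by (simp add: k_def)
  \<comment> \<open>A real \<open>k\<close> would make the displacement \<open>w * t + d\<close>
    vanish at \<open>t = - k\<close>.\<close>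
  have y: "Im k \<noteq> 0"
  proof
    assume "Im k = 0"
    then have "k = of_real (Re k)" by (simp add: complex_eq_iff)
    then have "w * of_real (- Re k) + d = 0" unfolding d by (simp add: algebra_simps)
    then show False using unipotent_nonvanishing[OF h(1) _ hid, of w d "- Re k"] h(2) by auto
  qed
  have conj: "- Re \<epsilon> * b = 2 * Im \<epsilon> * Im k" if g: "g \<in> \<Gamma>" "frame_map False \<epsilon> u a b g" for g \<epsilon> u a b
  proof -
    have "\<exists>m\<in>\<Gamma>. frame_map False 1 (\<epsilon> * w) (\<epsilon> * d - \<epsilon> * w * b) 0 m"
      using frame_map_quotient[OF comp_in[OF g(1) h(1)] g(1), of False \<epsilon>]
        frame_map_comp[OF g(2) h(2)] g(2) by fastforce
    then obtain m where m: "m \<in> \<Gamma>" "frame_map False 1 (\<epsilon> * w) (\<epsilon> * d - \<epsilon> * w * b) 0 m" by blast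
    have "Re (cnj w * (\<epsilon> * d - \<epsilon> * w * b)) = Re (cnj (\<epsilon> * w) * d)"
      using commuting[OF h(1) m(1) _ m(2)] h(2) by simp
    moreover have "cnj w * (\<epsilon> * d - \<epsilon> * w * b) = (cmod w)\<^sup>2 * (\<epsilon> * (k - b))"
      using complex_norm_square[of w] unfolding d by (simp add: algebra_simps)
    moreover have "cnj (\<epsilon> * w) * d = (cmod w)\<^sup>2 * (cnj \<epsilon> * k)"
      using complex_norm_square[of w] unfolding d by (simp add: algebra_simps)
    ultimately have "(cmod w)\<^sup>2 * Re (\<epsilon> * (k - b)) = (cmod w)\<^sup>2 * Re (cnj \<epsilon> * k)"
      by (metis Re_real_mult of_real_power)
    then have "Re (\<epsilon> * (k - b)) = Re (cnj \<epsilon> * k)" using h(3) by simp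
    then show ?thesis by (simp add: algebra_simps)
  qed
  have e1: "(Re \<epsilon>)\<^sup>2 + (Im \<epsilon>)\<^sup>2 = 1" using g(2) cmod_power2[of \<epsilon>] by (simp add: frame_map_def)
  have "frame_map False (\<epsilon> * \<epsilon>) (\<epsilon> * u + u) (\<epsilon> * a + u * b + a) (b + b) (g \<circ> g)"
    using frame_map_comp[OF g(2) g(2)] by simp
  then have "- Re (\<epsilon> * \<epsilon>) * (b + b) = 2 * Im (\<epsilon> * \<epsilon>) * Im k"
    by (rule conj[OF comp_in[OF g(1) g(1)]])
  then have e2: "- ((Re \<epsilon>)\<^sup>2 - (Im \<epsilon>)\<^sup>2) * (2 * b) = 2 * (2 * Im \<epsilon> * Re \<epsilon>) * Im k"
    by (simp add: power2_eq_square algebra_simps)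
  have im: "Im \<epsilon> = 0" and b: "b = 0"
    using double_angle_rigidity[OF e1 y conj[OF g] e2] by auto
  show "b = 0" by fact
  have "Re \<epsilon> = 1 \<or> Re \<epsilon> = -1" using e1 im by (simp add: power2_eq_1_iff)
  moreover have False if r: "Re \<epsilon> = -1"
  proof -
    have e: "\<epsilon> = -1" using r im by (simp add: complex_eq_iff)
    have c: "zc (g v) = - zc v + u * z3 v + a" "z3 (g v) = z3 v" for v
      using g(2) b e unfolding frame_map_def by auto
    \<comment> \<open>The centre of the half-turn on the level \<open>z3 = 0\<close> is
      \<open>a / 2\<close>.\<close>
    have "Q (g (pt 0 (a/2) 0) - id (pt 0 (a/2) 0)) = 0" by (simp add: Q_def coords_diff c)
    then have "g = id" using eqI_Q g id_in by (metis order_refl)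
    then show False using frame_map_unique(2)[OF g(2)] frame_map_id e by fastforce
  qed
  ultimately show "\<epsilon> = 1" using im by (auto simp: complex_eq_iff)
qed

text \<open>The square of an orientation reversing element preserves orientation and shifts
  \<open>z3\<close> by \<open>b + b\<close>.\<close>

lemma frame_map_b0:
  assumes g: "g \<in> \<Gamma>" "frame_map \<sigma> \<epsilon> u a b g"
  shows "b = 0"
proof (cases \<sigma>)
  case True
  have "frame_map False (\<epsilon> * cnj \<epsilon>) (\<epsilon> * cnj u + u) (\<epsilon> * cnj a + u * b + a) (b + b) (g \<circ> g)"
    using frame_map_comp[OF g(2) g(2)] True by simp
  then have "b + b = 0" using rotation_trivial(2) comp_in g(1) by blast
  then show ?thesis by simp
qed (use assms rotation_trivial in auto)

text \<open>Failure of the gap gives images of \<open>v\<close> that are close to it in the plane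
  but, by properness, escape along the null direction. Their cones fill an open half space on one
  side of the level of \<open>v\<close>, yet meet that level only in countably many lines, so their
  union is not closed near \<open>v\<close>.\<close>

lemma unipotent_gap:
  "\<exists>\<delta>>0. \<forall>g\<in>\<Gamma>. \<forall>u a. frame_map False 1 u a 0 g \<longrightarrow> g \<noteq> id \<longrightarrow> \<delta> \<le> cmod (u * of_real t + a)"
proof (rule ccontr)
  assume neg: "\<not> ?thesis"
  define v where "v = pt 0 0 t"
  have v [simp]: "z0 v = 0" "zc v = 0" "z3 v = t" by (simp_all add: v_def)
  define U where "U = {g \<in> \<Gamma>. g \<noteq> id \<and> (\<exists>u a. frame_map False 1 u a 0 g)}"
  have U: "zc (g v) \<noteq> 0 \<and> z3 (g v) = t" if "g \<in> U" for g
    using that unipotent_nonvanishing unfolding U_def frame_map_def by force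
  have small: "\<exists>g\<in>U. cmod (zc (g v)) < \<delta>" if d: "\<delta> > 0" for \<delta>
  proof -
    obtain g u a where g: "g \<in> \<Gamma>" "frame_map False 1 u a 0 g" "g \<noteq> id" "cmod (u * of_real t + a) < \<delta>"
      using neg d by (meson not_le)
    have "zc (g v) = u * t + a" using g(2) by (auto simp: frame_map_def)
    then show ?thesis using g unfolding U_def by (intro bexI[of _ g]) auto
  qed
  \<comment> \<open>If \<open>z0\<close> stayed bounded, only finitely many elements could have
    displacement below \<open>1\<close>, and their nonzero displacements would have a positive
    minimum.\<close>
  have escape: "\<exists>g\<in>U. cmod (zc (g v)) < 1 \<and> \<bar>z0 (g v)\<bar> > M" for M
  proof (rule ccontr)
    assume n: "\<not> ?thesis"
    define S where "S = {g \<in> U. cmod (zc (g v)) < 1}"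
    define R where "R = norm (pt 1 0 0) * \<bar>M\<bar> + norm (pt 0 1 0) + norm (pt 0 \<i> 0) + \<bar>t\<bar> * norm (pt 0 0 1) + norm v"
    have "dist v (g v) \<le> R" if g: "g \<in> S" for g
    proof -
      let ?z = "zc (g v)"
      have "\<bar>z0 (g v)\<bar> \<le> \<bar>M\<bar>" "cmod ?z \<le> 1" "z3 (g v) = t"
        using g n U by (force simp: S_def)+
      then have "\<bar>z0 (g v)\<bar> * norm (pt 1 0 0) \<le> \<bar>M\<bar> * norm (pt 1 0 0)"
        "\<bar>Re ?z\<bar> * norm (pt 0 1 0) \<le> 1 * norm (pt 0 1 0)"
        "\<bar>Im ?z\<bar> * norm (pt 0 \<i> 0) \<le> 1 * norm (pt 0 \<i> 0)"
        using abs_Re_le_cmod[of ?z] abs_Im_le_cmod[of ?z] by (intro mult_right_mono; simp)+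
      moreover have "norm (g v) \<le> \<bar>z0 (g v)\<bar> * norm (pt 1 0 0) + \<bar>Re ?z\<bar> * norm (pt 0 1 0)
          + \<bar>Im ?z\<bar> * norm (pt 0 \<i> 0) + \<bar>t\<bar> * norm (pt 0 0 1)"
        using pt_expand[of "z0 (g v)" ?z "z3 (g v)"] \<open>z3 (g v) = t\<close>
        by (metis (no_types, lifting) norm_add_rule_thm norm_scaleR order_refl pt_coords)
      ultimately have "norm (g v) + norm v \<le> R" unfolding R_def by (simp add: mult.commute)
      then show ?thesis using norm_triangle_ineq4[of v "g v"] by (simp add: dist_norm)
    qed
    then have "S \<subseteq> {g \<in> \<Gamma>. g v \<in> cball v R}" by (auto simp: S_def U_def)
    then have fin: "finite S" using proper finite_subset by blast
    \<comment> \<open>The inserted \<open>1\<close> covers an empty \<open>S\<close> and ensures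
      that an element with displacement below \<open>\<delta>\<close> belongs to
      \<open>S\<close>.\<close>
    define \<delta> where "\<delta> = Min (insert 1 ((\<lambda>g. cmod (zc (g v))) ` S))"
    have "\<delta> > 0" unfolding \<delta>_def using fin U by (subst Min_gr_iff) (auto simp: S_def)
    then obtain g where g: "g \<in> U" "cmod (zc (g v)) < \<delta>" using small by blast
    have "\<delta> \<le> 1" unfolding \<delta>_def using fin by simp
    then have "g \<in> S" using g by (simp add: S_def)
    then have "\<delta> \<le> cmod (zc (g v))" unfolding \<delta>_def using fin by simp
    then show False using g by simp
  qed
  \<comment> \<open>The escape happens with unbounded \<open>z0\<close> of at least one sign; this
    decides whether the futures or the pasts fill a half space.\<close>
  have "\<exists>s\<in>{1,-1}. \<forall>M. \<exists>g\<in>U. cmod (zc (g v)) < 1 \<and> s * z0 (g v) < - M"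
  proof (rule ccontr)
    assume "\<not> ?thesis"
    then obtain M1 M2 where "\<not> (\<exists>g\<in>U. cmod (zc (g v)) < 1 \<and> 1 * z0 (g v) < - M1)"
       "\<not> (\<exists>g\<in>U. cmod (zc (g v)) < 1 \<and> -1 * z0 (g v) < - M2)" by blast
    moreover obtain g where "g\<in>U" "cmod (zc (g v)) < 1" "\<bar>z0 (g v)\<bar> > \<bar>M1\<bar> + \<bar>M2\<bar>" using escape by blast
    ultimately show False by fastforce
  qed
  then obtain s :: real where s: "s \<in> {1, -1}"
    and far: "\<exists>g\<in>U. cmod (zc (g v)) < 1 \<and> s * z0 (g v) < - M" for M by blast
  have ss [simp]: "s * s = 1" using s by auto
  define F where "F = {g (v + s *\<^sub>R c) |g c. g \<in> \<Gamma> \<and> c \<in> C}"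
  have z3_inv: "z3 (g w) = z3 w" if g: "g \<in> \<Gamma>" for g w
  proof -
    obtain \<sigma> \<epsilon> u a b where f: "frame_map \<sigma> \<epsilon> u a b g" using frame_map_ex g by blast
    then show ?thesis using frame_map_b0[OF g f] by (auto simp: frame_map_def)
  qed
  have half: "x \<in> F" if x: "s * (z3 x - t) > 0" for x
  proof -
    define \<tau> where "\<tau> = s * (z3 x - t)"
    have "\<tau> > 0" using x by (simp add: \<tau>_def)
    \<comment> \<open>With this bound the product
      \<open>2 * (s * z0 x - s * z0 (g v)) * \<tau>\<close> exceeds the squared distance of
      \<open>x\<close> and \<open>g v\<close> in the plane, so
      \<open>Q (x - g v) \<ge> 0\<close>.\<close>
    define M where "M = (cmod (zc x) + 1)\<^sup>2 / (2 * \<tau>) - s * z0 x"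
    obtain g where g: "g \<in> U" "cmod (zc (g v)) < 1" "s * z0 (g v) < - M" using far by blast
    then have g\<Gamma>: "g \<in> \<Gamma>" by (simp add: U_def)
    obtain h where h: "h \<in> \<Gamma>" "g \<circ> h = id" "h \<circ> g = id" using inv_in[OF g\<Gamma>] by blast
    then have hg: "h (g w) = w" "g (h w) = w" for w by (metis comp_apply id_apply)+
    define c where "c = s *\<^sub>R (h x - v)"
    obtain \<sigma> \<epsilon> u a b where "frame_map \<sigma> \<epsilon> u a b h" using frame_map_ex[OF h(1)] by blast
    then have "Q (h x - h (g v)) = Q (x - g v)" by (rule Q_frame_map)
    moreover have "Q c = Q (h x - v)"
      using s by (auto simp: Q_def c_def coords_scale coords_diff norm_minus_commute algebra_simps)
    ultimately have "Q c = Q (x - g v)" by (simp add: hg)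
    also have "\<dots> = 2 * (s * z0 x - s * z0 (g v)) * \<tau> - (cmod (zc x - zc (g v)))\<^sup>2"
      using s U[OF g(1)] by (auto simp: Q_def \<tau>_def coords_diff)
    also have "\<dots> \<ge> 0"
    proof -
      have "cmod (zc x - zc (g v)) \<le> cmod (zc x) + 1"
        using norm_triangle_ineq4[of "zc x" "zc (g v)"] g(2) by linarith
      then have "(cmod (zc x - zc (g v)))\<^sup>2 \<le> (cmod (zc x) + 1)\<^sup>2" by (intro power_mono) auto
      also have "\<dots> = 2 * (M + s * z0 x) * \<tau>" using \<open>\<tau> > 0\<close> by (simp add: M_def)
      also have "\<dots> \<le> 2 * (s * z0 x - s * z0 (g v)) * \<tau>"
        using g(3) \<open>\<tau> > 0\<close> by (intro mult_right_mono) auto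
      finally show ?thesis by simp
    qed
    finally have "Q c \<ge> 0" .
    moreover have "z3 c > 0" using x by (simp add: c_def coords_scale coords_diff z3_inv[OF h(1)])
    ultimately have "c \<in> C" using cone_memI by blast
    moreover have "x = g (v + s *\<^sub>R c)" by (simp add: c_def hg)
    ultimately show ?thesis using g\<Gamma> unfolding F_def by blast
  qed
  obtain N where N: "open N" "v \<in> N" "open (N - F)" using strict[OF s, of v] unfolding F_def by blast
  \<comment> \<open>A boundary point of the half space is a limit of points of \<open>F\<close>, so
    it cannot lie in the open set \<open>N - F\<close>.\<close>
  have slice: "x \<in> F" if x: "x \<in> N" "z3 x = t" for x
  proof (rule ccontr)
    assume "x \<notin> F"
    then obtain e where e: "e > 0" "ball x e \<subseteq> N - F" using N(3) x by (metis DiffI open_contains_ball)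
    define r where "r = e / (2 * (norm (pt 0 0 1) + 1))"
    have n: "norm (pt 0 0 1) + 1 > 0" by (simp add: add_nonneg_pos)
    have r: "r > 0" using e n by (simp add: r_def)
    let ?y = "x + (r * s) *\<^sub>R pt 0 0 1"
    have "norm ((r * s) *\<^sub>R pt 0 0 1) = r * norm (pt 0 0 1)" using s r by (auto simp: abs_mult)
    also have "\<dots> < e" using e n by (simp add: r_def field_simps add_pos_nonneg)
    finally have "?y \<in> ball x e" by (simp add: dist_norm)
    moreover have "?y \<in> F" using r s x by (intro half) (auto simp: coords_add coords_scale)
    ultimately show False using e by blast
  qed
  \<comment> \<open>A vector of \<open>C\<close> with \<open>z3 c = 0\<close> lies on the null line,
    so it does not change the plane coordinate.\<close>
  have lines: "zc x \<in> (\<lambda>g. zc (g v)) ` \<Gamma>" if x: "x \<in> F" "z3 x = t" for x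
  proof -
    obtain g c where g: "g \<in> \<Gamma>" "c \<in> C" "x = g (v + s *\<^sub>R c)" using x unfolding F_def by blast
    have "z3 c = 0" using z3_inv[OF g(1), of "v + s *\<^sub>R c"] x g(3) s by (auto simp: coords_add coords_scale)
    then have "zc c = 0" using cone_memD[OF g(2)] by (simp add: Q_def)
    obtain \<sigma> \<epsilon> u a b where "frame_map \<sigma> \<epsilon> u a b g" using frame_map_ex g(1) by blast
    then have "zc x = zc (g v)"
      using \<open>z3 c = 0\<close> \<open>zc c = 0\<close> unfolding g(3) frame_map_def by (auto simp: coords_add coords_scale)
    then show ?thesis using g(1) by blast
  qed
  have cont: "continuous_on UNIV (\<lambda>y. pt 0 (complex_of_real y) t)"
    by (subst pt_expand) (intro continuous_intros)
  \<comment> \<open>A real interval of plane coordinates inside \<open>N\<close> is uncountable,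
    whereas \<open>slice\<close> and \<open>lines\<close> confine it to a countable set.\<close>
  define Y where "Y = (\<lambda>y. pt 0 (complex_of_real y) t) -` N"
  have "open Y" unfolding Y_def using open_vimage[OF N(1) cont] .
  moreover have "0 \<in> Y" using N(2) by (simp add: Y_def v_def)
  ultimately obtain \<epsilon> where "\<epsilon> > 0" "cball 0 \<epsilon> \<subseteq> Y" using open_contains_cball by blast
  then have "uncountable Y" using uncountable_cball countable_subset by blast
  have "complex_of_real ` Y \<subseteq> (\<lambda>g. zc (g v)) ` \<Gamma>"
  proof
    fix z assume "z \<in> complex_of_real ` Y"
    then have "pt 0 z t \<in> N" by (auto simp: Y_def)
    then show "z \<in> (\<lambda>g. zc (g v)) ` \<Gamma>" using lines[OF slice, of "pt 0 z t"] by simp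
  qed
  then have "countable (complex_of_real ` Y)" using countable by (meson countable_image countable_subset)
  then have "countable Y" by (rule countable_image_inj_on) (simp add: inj_on_def)
  then show False using \<open>uncountable Y\<close> by blast
qed

section \<open>The discrete group of unipotent parameters and its cyclicity\<close>

definition L :: "(complex \<times> complex) set" where
  "L = {(u, a). \<exists>g\<in>\<Gamma>. frame_map False 1 u a 0 g}"

lemma zero_in_L: "(0, 0) \<in> L"
  using id_in frame_map_id by (auto simp: L_def)

lemma diff_in_L: "(u, a) \<in> L \<Longrightarrow> (w, d) \<in> L \<Longrightarrow> (u - w, a - d) \<in> L"
  unfolding L_def using frame_map_quotient by fastforce

lemma add_in_L: "(u, a) \<in> L \<Longrightarrow> (w, d) \<in> L \<Longrightarrow> (u + w, a + d) \<in> L"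
  using diff_in_L[of u a "0 - w" "0 - d"] diff_in_L[OF zero_in_L, of w d] by simp

lemma scale_in_L:
  assumes "(u, a) \<in> L"
  shows "(of_int n * u, of_int n * a) \<in> L"
proof (induction n rule: int_induct[where k = 0])
  case base
  show ?case by (simp add: zero_in_L)
next
  case (step1 i)
  then show ?case using add_in_L[OF step1(2) assms] by (simp add: algebra_simps)
next
  case (step2 i)
  then show ?case using diff_in_L[OF step2(2) assms] by (simp add: algebra_simps)
qed

lemma L_gap: "\<exists>\<delta>>0. \<forall>(u, a)\<in>L. (u, a) \<noteq> (0, 0) \<longrightarrow> \<delta> \<le> cmod (u * of_real t + a)"
proof -
  obtain \<delta> where d: "\<delta> > 0"
    and g: "\<And>g u a. g \<in> \<Gamma> \<Longrightarrow> frame_map False 1 u a 0 g \<Longrightarrow> g \<noteq> id \<Longrightarrow> \<delta> \<le> cmod (u * of_real t + a)"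
    using unipotent_gap by blast
  have "g \<noteq> id" if "frame_map False 1 u a 0 g" "(u, a) \<noteq> (0, 0)" for g u a
    using frame_map_unique(3,4)[OF that(1)] frame_map_id that(2) by blast
  then show ?thesis using d g unfolding L_def by (intro exI[of _ \<delta>]) fastforce
qed

lemma L_nonvanishing: "(u, a) \<in> L \<Longrightarrow> (u, a) \<noteq> (0, 0) \<Longrightarrow> u * of_real t + a \<noteq> 0"
  using L_gap[of t] by fastforce

lemma L_symplectic: "(u, a) \<in> L \<Longrightarrow> (w, d) \<in> L \<Longrightarrow> Re (cnj u * d) = Re (cnj w * a)"
  unfolding L_def using commuting by blast

text \<open>A real slope would give the level \<open>t = - a / u\<close> at which the displacement
  vanishes.\<close>

lemma L_slope_nonreal:
  assumes "(u, a) \<in> L" "u \<noteq> 0"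
  shows "Im (a / u) \<noteq> 0"
proof
  assume "Im (a / u) = 0"
  then have "a / u = of_real (Re (a / u))" by (simp add: complex_eq_iff)
  then have "a = of_real (Re (a / u)) * u" using assms(2) by (metis nonzero_eq_divide_eq)
  then have "u * of_real (- Re (a / u)) + a = 0" by (simp add: algebra_simps)
  then show False using L_nonvanishing assms by blast
qed

text \<open>The symplectic relation provides a level \<open>t\<close> at which both displacements
  are parallel. Dirichlet approximation of their ratio gives an integer combination with
  displacement below the gap at that level; it is therefore zero, and the two pairs are rationally
  proportional.\<close>

lemma L_proportional:
  assumes 1: "(u, a) \<in> L" "u \<noteq> 0" and 2: "(w, d) \<in> L"
  shows "\<exists>\<rho>::real. w = \<rho> * u \<and> d = \<rho> * a"
proof -
  define k where "k = a / u"
  define \<mu> where "\<mu> = w / u"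
  define \<alpha> where "\<alpha> = d / u"
  have eqs: "a = k * u" "w = \<mu> * u" "d = \<alpha> * u" using 1(2) by (simp_all add: k_def \<mu>_def \<alpha>_def)
  have y: "Im k \<noteq> 0" using L_slope_nonreal[OF 1] by (simp add: k_def)
  have "cnj u * d = (cmod u)\<^sup>2 * \<alpha>" "cnj w * a = (cmod u)\<^sup>2 * (cnj \<mu> * k)"
    using complex_norm_square[of u] unfolding eqs by (simp_all add: algebra_simps)
  then have "(cmod u)\<^sup>2 * Re \<alpha> = (cmod u)\<^sup>2 * Re (cnj \<mu> * k)"
    using L_symplectic[OF 1(1) 2] by (metis Re_real_mult of_real_power)
  then have sym: "Re \<alpha> = Re \<mu> * Re k + Im \<mu> * Im k" using 1(2) by simp
  \<comment> \<open>With \<open>t = T - Re k\<close> and the relation \<open>sym\<close>,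
    parallelism of \<open>t + k\<close> and \<open>\<mu> * t + \<alpha>\<close> over the reals
    becomes this quadratic equation.\<close>
  obtain T where T: "Im \<mu> * T\<^sup>2 + (Im \<alpha> - Im \<mu> * Re k - Im k * Re \<mu>) * T - (Im k)\<^sup>2 * Im \<mu> = 0"
    using quadratic_real_root by blast
  define t where "t = T - Re k"
  have "Im (cnj (of_real t + k) * (\<mu> * of_real t + \<alpha>)) = 0"
    using T unfolding t_def by (simp add: sym power2_eq_square algebra_simps)
  moreover have nz: "of_real t + k \<noteq> 0" using y by (auto simp: complex_eq_iff)
  moreover have "(\<mu> * of_real t + \<alpha>) / (of_real t + k)
      = cnj (of_real t + k) * (\<mu> * of_real t + \<alpha>) / of_real ((cmod (of_real t + k))\<^sup>2)"
    using nz complex_div_cnj by (metis mult.commute of_real_power)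
  ultimately have "Im ((\<mu> * of_real t + \<alpha>) / (of_real t + k)) = 0"
    by (metis Im_divide_of_real div_0)
  then obtain \<rho> where "(\<mu> * of_real t + \<alpha>) / (of_real t + k) = of_real \<rho>"
    using complex_is_Real_iff Reals_cases by metis
  then have "\<mu> * of_real t + \<alpha> = \<rho> * (of_real t + k)" using nz by (simp add: field_simps)
  then have par: "w * t + d = \<rho> * (u * t + a)" unfolding eqs by (metis distrib_right mult.assoc mult.commute)
  obtain \<delta> where \<delta>: "\<delta> > 0" "\<And>u a. (u, a) \<in> L \<Longrightarrow> (u, a) \<noteq> (0, 0) \<Longrightarrow> \<delta> \<le> cmod (u * of_real t + a)"
    using L_gap[of t] by fastforce
  define m where "m = cmod (u * t + a)"
  \<comment> \<open>The approximation error is below \<open>1 / N\<close>, and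
    \<open>m / N < \<delta>\<close> puts the combined displacement below the gap.\<close>
  obtain N where N: "N > 0" "m / \<delta> < real N" using reals_Archimedean2[of "max 0 (m/\<delta>)"] by auto
  obtain h k' where hk: "0 < k'" "\<bar>of_int k' * \<rho> - of_int h\<bar> < 1 / N" by (rule Dirichlet_approx[OF N(1)])
  let ?p = "(of_int k' * w - of_int h * u, of_int k' * d - of_int h * a)"
  have inL: "?p \<in> L" using diff_in_L[OF scale_in_L[OF 2] scale_in_L[OF 1(1)]] by blast
  have "(of_int k' * w - of_int h * u) * t + (of_int k' * d - of_int h * a)
      = of_int k' * (w * t + d) - of_int h * (u * t + a)" by (simp add: algebra_simps)
  also have "\<dots> = of_real (of_int k' * \<rho> - of_int h) * (u * t + a)" unfolding par by (simp add: algebra_simps)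
  finally have "cmod ((of_int k' * w - of_int h * u) * t + (of_int k' * d - of_int h * a))
      = \<bar>of_int k' * \<rho> - of_int h\<bar> * m" by (simp only: norm_mult norm_of_real m_def)
  also have "\<dots> \<le> 1 / N * m" using hk by (intro mult_right_mono) (auto simp: m_def)
  also have "\<dots> < \<delta>" using N \<delta>(1) by (simp add: field_simps)
  finally have "?p = (0, 0)" using \<delta>(2)[OF inL] by force
  then have "w = of_real (h / k') * u" "d = of_real (h / k') * a" using hk(1) by (simp_all add: field_simps)
  then show ?thesis by blast
qed

text \<open>By proportionality \<open>L\<close> lies on the real line through one pair, and the gap
  at the level \<open>0\<close> makes the scalars a discrete subgroup of the reals.\<close>

lemma L_cyclic: "\<exists>u a. u \<noteq> 0 \<and> L = range (\<lambda>n. (of_int n * u, of_int n * a))"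
proof -
  obtain g w d b where g: "g \<in> \<Gamma>" "frame_map False 1 w d b g" "w \<noteq> 0" using ex_parabolic by blast
  then have wd: "(w, d) \<in> L" using unipotent_b0[OF g(1,2)] by (auto simp: L_def)
  define S where "S = {s::real. (s * w, s * d) \<in> L}"
  obtain \<delta> where \<delta>: "\<delta> > 0" "\<And>u a. (u, a) \<in> L \<Longrightarrow> (u, a) \<noteq> (0, 0) \<Longrightarrow> \<delta> \<le> cmod (u * of_real 0 + a)"
    using L_gap[of 0] by fastforce
  have d0: "d \<noteq> 0" using L_nonvanishing[OF wd, of 0] g(3) by auto
  have "\<exists>r>0. S = range (\<lambda>n. of_int n * r)"
  proof (rule discrete_subgroup_real)
    show "x - y \<in> S" if "x \<in> S" "y \<in> S" for x y
      using diff_in_L[of "x * w" "x * d" "y * w" "y * d"] that by (simp add: S_def algebra_simps)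
    show "\<delta> / cmod d > 0" using \<delta> d0 by simp
    show "\<delta> / cmod d \<le> \<bar>x\<bar>" if "x \<in> S" "x \<noteq> 0" for x
      using \<delta>(2)[of "x * w" "x * d"] that d0 by (simp add: S_def norm_mult field_simps)
    show "1 \<in> S" using wd by (simp add: S_def)
  qed simp
  then obtain r where r: "r > 0" "S = range (\<lambda>n. of_int n * r)" by blast
  have "L = range (\<lambda>n. (of_int n * (r * w), of_int n * (r * d)))"
  proof (intro set_eqI iffI)
    fix p assume p: "p \<in> L"
    then obtain x y where xy: "p = (x, y)" by fastforce
    then obtain \<rho> where \<rho>: "x = of_real \<rho> * w" "y = of_real \<rho> * d"
      using L_proportional[OF wd g(3)] p by blast
    then have "\<rho> \<in> S" using p xy by (simp add: S_def)
    then obtain n where "\<rho> = of_int n * r" using r by blast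
    then show "p \<in> range (\<lambda>n. (of_int n * (r * w), of_int n * (r * d)))"
      using xy \<rho> by (auto simp: algebra_simps)
  next
    fix p assume "p \<in> range (\<lambda>n. (of_int n * (r * w), of_int n * (r * d)))"
    then obtain n where n: "p = (of_int n * (r * w), of_int n * (r * d))" by blast
    have "of_int n * r \<in> S" using r by blast
    then show "p \<in> L" using n by (simp add: S_def mult.assoc)
  qed
  then show ?thesis using r g(3) by (intro exI[of _ "r * w"] exI[of _ "r * d"]) simp
qed

text \<open>Conjugation by a reflection sends the pair \<open>(w, d)\<close> to
  \<open>(\<epsilon> * cnj w, \<epsilon> * cnj d)\<close>. Proportionality then gives
  \<open>cnj (d / w) = d / w\<close>, but slopes are not real.\<close>

lemma no_reflections:
  assumes g: "g \<in> \<Gamma>" "frame_map True \<epsilon> u a b g"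
  shows False
proof -
  obtain h w d b' where h: "h \<in> \<Gamma>" "frame_map False 1 w d b' h" "w \<noteq> 0" using ex_parabolic by blast
  then have [simp]: "b' = 0" using unipotent_b0 by blast
  have wd: "(w, d) \<in> L" using h by (auto simp: L_def)
  have "\<exists>m\<in>\<Gamma>. frame_map False 1 (\<epsilon> * cnj w) (\<epsilon> * cnj d) 0 m"
    using frame_map_quotient[OF comp_in[OF g(1) h(1)] g(1), of True \<epsilon>]
      frame_map_comp[OF g(2) h(2)] g(2) frame_map_b0[OF g] by fastforce
  then have "(\<epsilon> * cnj w, \<epsilon> * cnj d) \<in> L" by (auto simp: L_def)
  then obtain \<rho> where \<rho>: "\<epsilon> * cnj w = of_real \<rho> * w" "\<epsilon> * cnj d = of_real \<rho> * d"
    using L_proportional[OF wd h(3)] by blast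
  have e: "\<epsilon> \<noteq> 0" using g(2) by (auto simp: frame_map_def)
  then have "\<rho> \<noteq> 0" using \<rho>(1) h(3) by auto
  then have "(\<epsilon> * cnj d) / (\<epsilon> * cnj w) = d / w" unfolding \<rho> by simp
  then have "cnj (d / w) = d / w" using e by simp
  then have "Im (cnj (d / w)) = Im (d / w)" by (rule arg_cong)
  then show False using L_slope_nonreal[OF wd h(3)] unfolding cnj.sel by simp
qed

section \<open>The generator and its normal form\<close>

lemma group_generator:
  "\<exists>u a. u \<noteq> 0 \<and> Im (a / u) \<noteq> 0 \<and> (\<exists>g\<in>\<Gamma>. frame_map False 1 u a 0 g) \<and>
     (\<forall>g\<in>\<Gamma>. \<exists>n. frame_map False 1 (of_int n * u) (of_int n * a) 0 g)"
proof -
  obtain u a where ua: "u \<noteq> 0" "L = range (\<lambda>n. (of_int n * u, of_int n * a))" using L_cyclic by blast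
  have "(of_int 1 * u, of_int 1 * a) \<in> L" using ua(2) by blast
  then have "(u, a) \<in> L" by simp
  moreover have "\<exists>n. frame_map False 1 (of_int n * u) (of_int n * a) 0 g" if g: "g \<in> \<Gamma>" for g
  proof -
    obtain \<sigma> \<epsilon> w d b where f: "frame_map \<sigma> \<epsilon> w d b g" using frame_map_ex g by blast
    have "\<not> \<sigma>" using no_reflections g f by (cases \<sigma>) auto
    then have f': "frame_map False 1 w d 0 g" using f g rotation_trivial by (metis (full_types))
    then have "(w, d) \<in> L" using g by (auto simp: L_def)
    then show ?thesis using ua(2) f' by auto
  qed
  ultimately show ?thesis using ua(1) L_slope_nonreal[of u a] unfolding L_def by blast
qed

text \<open>Dividing \<open>zc\<close> by \<open>u\<close> turns the generator into the translation
  by \<open>z3 + a / u\<close> on the plane. Shifting \<open>z3\<close> by the real part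
  \<open>x\<close> of the slope and dividing by its imaginary part \<open>y\<close> produces the
  model; the form is scaled by \<open>1 / (r * y\<^sup>2)\<close>.\<close>

lemma conjugate_to_Gamma0:
  "\<exists>F A k \<tau>. \<tau> > 0 \<and> linear A \<and> (\<forall>v. F v = A v + k) \<and> bij F \<and>
     (\<forall>x y. form0 (A x) (A y) = \<tau> * (z0 x * z3 y + z3 x * z0 y
        - Re (zc x) * Re (zc y) - Im (zc x) * Im (zc y))) \<and>
     (\<forall>g\<in>\<Gamma>. \<exists>n. \<forall>v. F (g v) = gamma0 n (F v)) \<and> (\<forall>n. \<exists>g\<in>\<Gamma>. \<forall>v. F (g v) = gamma0 n (F v))"
proof -
  obtain u a g where ua: "u \<noteq> 0" "Im (a / u) \<noteq> 0" "g \<in> \<Gamma>" "frame_map False 1 u a 0 g"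
    and gen: "\<And>h. h \<in> \<Gamma> \<Longrightarrow> \<exists>n. frame_map False 1 (of_int n * u) (of_int n * a) 0 h"
    using group_generator by blast
  obtain c where c: "zc (g v) = zc v + u * z3 v + a" "z3 (g v) = z3 v"
     "z0 (g v) = z0 v + Re (cnj u * zc v) + (cmod u)\<^sup>2 / 2 * z3 v + c" for v
    using ua(4) unfolding frame_map_def by auto
  define x where "x = Re (a / u)"
  define y where "y = Im (a / u)"
  define r where "r = (cmod u)\<^sup>2"
  define \<zeta> where "\<zeta> v = zc v / u" for v
  have zc: "zc v = u * \<zeta> v" for v using ua(1) by (simp add: \<zeta>_def)
  have r: "r > 0" using ua(1) by (simp add: r_def)
  have y: "y \<noteq> 0" using ua(2) by (simp add: y_def)
  have rr: "r = Re u * Re u + Im u * Im u" unfolding r_def cmod_power2 by (simp add: power2_eq_square)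
  \<comment> \<open>This shift of the third model coordinate absorbs the constant \<open>c\<close>
    of the \<open>z0\<close> row.\<close>
  define \<kappa> where "\<kappa> = (c / r - x / 2) / y"
  have \<zeta>g: "\<zeta> (g v) = \<zeta> v + z3 v + Complex x y" for v
    unfolding \<zeta>_def c x_def y_def using ua(1) by (simp add: add_divide_distrib)
  have z0g: "z0 (g v) = z0 v + r * Re (\<zeta> v) + r / 2 * z3 v + c" for v
    unfolding c zc rr r_def[symmetric] by (simp add: algebra_simps)
  have lin\<zeta>: "\<zeta> (v + w) = \<zeta> v + \<zeta> w" "\<zeta> (s *\<^sub>R v) = s *\<^sub>R \<zeta> v" for v w s
    by (simp_all add: \<zeta>_def coords_add coords_scale add_divide_distrib scaleR_conv_of_real)
  define A :: "'a \<Rightarrow> real^4" where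
    "A v = vector [z0 v / (r * y), Im (\<zeta> v) / y, Re (\<zeta> v) / y, z3 v / y]" for v
  define k :: "real^4" where "k = vector [0, 0, \<kappa>, x / y]"
  define F where "F v = A v + k" for v
  define G where "G w = pt (r * y * w$1) (u * Complex (y * (w$3 - \<kappa>)) (y * w$2)) (y * w$4 - x)"
    for w :: "real^4"
  have linA: "linear A"
    by (rule linearI)
      (simp_all add: A_def vec_eq_iff forall_4 vector_4 coords_add coords_scale lin\<zeta> add_divide_distrib)
  have F: "F v $ 1 = z0 v / (r * y)" "F v $ 2 = Im (\<zeta> v) / y"
    "F v $ 3 = Re (\<zeta> v) / y + \<kappa>" "F v $ 4 = (z3 v + x) / y" for v
    by (simp_all add: F_def A_def k_def vector_4 add_divide_distrib)
  have "F (G w) = w" for w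
    unfolding vec_eq_iff forall_4 F unfolding G_def using y r ua(1) by (simp add: \<zeta>_def)
  moreover have "G (F v) = v" for v
  proof (rule coords_eqI)
    show "z0 (G (F v)) = z0 v" "z3 (G (F v)) = z3 v" using y r by (simp_all add: G_def F)
    have "Complex (y * (F v $ 3 - \<kappa>)) (y * F v $ 2) = \<zeta> v"
      using y by (simp add: F complex_eq_iff)
    then show "zc (G (F v)) = zc v" by (metis G_def pt_simps(2) zc)
  qed
  ultimately have "bij F" by (metis bij_iff)
  have Fg: "F (g v) = gamma0 1 (F v)" for v
    unfolding vec_eq_iff forall_4 gamma0_components F \<zeta>g z0g c
    using y r by (simp add: \<kappa>_def field_simps)
  have add: "gamma0 m (gamma0 n w) = gamma0 (m + n) w" for m n w
    unfolding vec_eq_iff forall_4 gamma0_components by (simp add: power2_eq_square field_simps)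
  have zero: "gamma0 0 w = w" for w
    unfolding vec_eq_iff forall_4 gamma0_components by simp
  obtain h where h: "h \<in> \<Gamma>" "g \<circ> h = id" using inv_in ua(3) by blast
  have "g (h v) = v" for v using h(2) by (metis comp_apply id_apply)
  then have Fh: "F (h v) = gamma0 (-1) (F v)" for v
    using Fg[of "h v"] add[of "-1" 1 "F (h v)"] by (simp add: zero)
  have hf: "frame_map False 1 (- u) (- a) 0 h"
  proof -
    obtain m where m: "m \<in> \<Gamma>" "id = m \<circ> g" "frame_map False 1 (- u) (- a) 0 m"
      using frame_map_quotient[OF id_in ua(3) frame_map_id ua(4)] by auto
    have "m = m \<circ> (g \<circ> h)" using h(2) by simp
    also have "\<dots> = h" using m(2) by (simp add: o_assoc[symmetric] flip: comp_assoc)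
    finally show ?thesis using m(3) by simp
  qed
  have powers: "\<exists>f\<in>\<Gamma>. frame_map False 1 (of_int n * u) (of_int n * a) 0 f \<and> (\<forall>v. F (f v) = gamma0 n (F v))" for n
  proof (induction n rule: int_induct[where k = 0])
    case base
    have "frame_map False 1 (of_int 0 * u) (of_int 0 * a) 0 id" using frame_map_id by simp
    moreover have "\<forall>v. F (id v) = gamma0 0 (F v)" by (simp add: zero)
    ultimately show ?case using id_in by blast
  next
    case (step1 i)
    then obtain f where f: "f \<in> \<Gamma>" "frame_map False 1 (of_int i * u) (of_int i * a) 0 f"
      "\<forall>v. F (f v) = gamma0 i (F v)" by blast
    have "frame_map False 1 (of_int (i + 1) * u) (of_int (i + 1) * a) 0 (g \<circ> f)"
      using frame_map_comp[OF ua(4) f(2)] by (simp add: algebra_simps)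
    moreover have "\<forall>v. F ((g \<circ> f) v) = gamma0 (i + 1) (F v)" using f(3) by (simp add: Fg add add.commute)
    ultimately show ?case using comp_in[OF ua(3) f(1)] by blast
  next
    case (step2 i)
    then obtain f where f: "f \<in> \<Gamma>" "frame_map False 1 (of_int i * u) (of_int i * a) 0 f"
      "\<forall>v. F (f v) = gamma0 i (F v)" by blast
    have "frame_map False 1 (of_int (i - 1) * u) (of_int (i - 1) * a) 0 (h \<circ> f)"
      using frame_map_comp[OF hf f(2)] by (simp add: algebra_simps)
    moreover have "\<forall>v. F ((h \<circ> f) v) = gamma0 (i - 1) (F v)" using f(3) by (simp add: Fh add)
    ultimately show ?case using comp_in[OF h(1) f(1)] by blast
  qed
  \<comment> \<open>Equal parameters leave the constant in \<open>z0\<close> open. The quotient of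
    two such elements has zero plane displacement, so it is the identity by
    \<open>unipotent_nonvanishing\<close>.\<close>
  have "\<exists>n. \<forall>v. F (f v) = gamma0 n (F v)" if f: "f \<in> \<Gamma>" for f
  proof -
    obtain n where n: "frame_map False 1 (of_int n * u) (of_int n * a) 0 f" using gen[OF f] by blast
    obtain f' where f': "f' \<in> \<Gamma>" "frame_map False 1 (of_int n * u) (of_int n * a) 0 f'"
      "\<forall>v. F (f' v) = gamma0 n (F v)" using powers by blast
    obtain m where m: "m \<in> \<Gamma>" "f = m \<circ> f'" "frame_map False 1 0 0 0 m"
      using frame_map_quotient[OF f f'(1) n f'(2)] by auto
    have "m = id" using unipotent_nonvanishing[OF m(1,3), of 0] by auto
    then show ?thesis using f' m by auto
  qed
  moreover have "form0 (A v) (A w) = 1 / (r * y\<^sup>2) * (z0 v * z3 w + z3 v * z0 w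
        - Re (zc v) * Re (zc w) - Im (zc v) * Im (zc w))" for v w
  proof -
    have "Re (zc v) * Re (zc w) + Im (zc v) * Im (zc w) = r * (Re (\<zeta> v) * Re (\<zeta> w) + Im (\<zeta> v) * Im (\<zeta> w))"
      unfolding zc rr by (simp add: algebra_simps)
    then have e: "z0 v * z3 w + z3 v * z0 w - Re (zc v) * Re (zc w) - Im (zc v) * Im (zc w)
       = z0 v * z3 w + z3 v * z0 w - r * (Re (\<zeta> v) * Re (\<zeta> w) + Im (\<zeta> v) * Im (\<zeta> w))" by simp
    show ?thesis unfolding e unfolding form0_def A_def vector_4
      using r y by (simp add: field_simps power2_eq_square)
  qed
  moreover have "1 / (r * y\<^sup>2) > 0" using r y by simp
  ultimately show ?thesis
    using linA F_def \<open>bij F\<close> powers by (intro exI[of _ F] exI[of _ A] exI[of _ k] exI[of _ "1 / (r * y\<^sup>2)"]) blast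
qed

end

section \<open>Recognizing linear isometries as frame maps\<close>

context null_frame begin

text \<open>Pairing with the fixed null vector shows that \<open>z3\<close> is preserved, pairing
  with the image of \<open>pt 0 0 1\<close> determines the \<open>z0\<close> row, and the plane part
  is orthogonal. The point \<open>pt (1/2) 0 1\<close> will be \<open>e\<close>, so that the last
  two equations relate \<open>cmod u\<close> to the height.\<close>

lemma frame_map_of_affine:
  assumes lin: "linear A"
    and iso: "\<And>v w. z0 (A v) * z3 (A w) + z3 (A v) * z0 (A w)
        - Re (zc (A v)) * Re (zc (A w)) - Im (zc (A v)) * Im (zc (A w))
      = z0 v * z3 w + z3 v * z0 w - Re (zc v) * Re (zc w) - Im (zc v) * Im (zc w)"
    and fixed: "A (pt 1 0 0) = pt 1 0 0"
  shows "\<exists>\<sigma> \<epsilon> u. frame_map \<sigma> \<epsilon> u (zc k) (z3 k) (\<lambda>v. A v + k) \<and>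
    z0 (A (pt (1/2) 0 1)) = (1 + (cmod u)\<^sup>2) / 2 \<and> z3 (A (pt (1/2) 0 1)) = 1"
proof -
  define \<alpha> where "\<alpha> = zc (A (pt 0 1 0))"
  define \<beta> where "\<beta> = zc (A (pt 0 \<i> 0))"
  define u where "u = zc (A (pt 0 0 1))"
  have z3: "z3 (A v) = z3 v" for v
    using iso[of v "pt 1 0 0"] by (simp add: fixed)
  have za: "z0 (A (pt 0 1 0)) = Re \<alpha> * Re u + Im \<alpha> * Im u"
    using iso[of "pt 0 1 0" "pt 0 0 1"] by (simp add: z3 \<alpha>_def u_def)
  have zb: "z0 (A (pt 0 \<i> 0)) = Re \<beta> * Re u + Im \<beta> * Im u"
    using iso[of "pt 0 \<i> 0" "pt 0 0 1"] by (simp add: z3 \<beta>_def u_def)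
  have zq: "z0 (A (pt 0 0 1)) = (cmod u)\<^sup>2 / 2"
    using iso[of "pt 0 0 1" "pt 0 0 1"] unfolding cmod_power2 by (simp add: z3 u_def power2_eq_square)
  have A: "A v = z0 v *\<^sub>R A (pt 1 0 0) + Re (zc v) *\<^sub>R A (pt 0 1 0) + Im (zc v) *\<^sub>R A (pt 0 \<i> 0)
      + z3 v *\<^sub>R A (pt 0 0 1)" for v
  proof -
    have "A v = A (pt (z0 v) (zc v) (z3 v))" by simp
    also have "\<dots> = z0 v *\<^sub>R A (pt 1 0 0) + Re (zc v) *\<^sub>R A (pt 0 1 0) + Im (zc v) *\<^sub>R A (pt 0 \<i> 0)
      + z3 v *\<^sub>R A (pt 0 0 1)"
      by (subst pt_expand) (simp only: linear_add[OF lin] linear_scale[OF lin])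
    finally show ?thesis .
  qed
  have z0: "z0 (A v) = z0 v + Re (zc v) * (Re \<alpha> * Re u + Im \<alpha> * Im u)
      + Im (zc v) * (Re \<beta> * Re u + Im \<beta> * Im u) + (cmod u)\<^sup>2 / 2 * z3 v" for v
    by (subst A) (simp add: coords_add coords_scale fixed za zb zq)
  have zc: "zc (A v) = Re (zc v) * \<alpha> + Im (zc v) * \<beta> + u * z3 v" for v
    by (subst A) (simp add: coords_add coords_scale fixed \<alpha>_def \<beta>_def u_def scaleR_conv_of_real)
  have a: "Re \<alpha> * Re \<alpha> + Im \<alpha> * Im \<alpha> = 1"
    using iso[of "pt 0 1 0" "pt 0 1 0"] by (simp add: z3 \<alpha>_def)
  have b: "Re \<beta> * Re \<beta> + Im \<beta> * Im \<beta> = 1"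
    using iso[of "pt 0 \<i> 0" "pt 0 \<i> 0"] by (simp add: z3 \<beta>_def)
  have ab: "Re \<alpha> * Re \<beta> + Im \<alpha> * Im \<beta> = 0"
    using iso[of "pt 0 1 0" "pt 0 \<i> 0"] by (simp add: z3 \<alpha>_def \<beta>_def)
  \<comment> \<open>The determinant of the plane part, whose sign separates rotations from
    reflections.\<close>
  define d where "d = Re \<alpha> * Im \<beta> - Im \<alpha> * Re \<beta>"
  have "d * d = 1" using a b ab unfolding d_def by algebra
  then have "d = 1 \<or> d = -1" by (simp add: square_eq_1_iff)
  moreover have "Re \<beta> = - d * Im \<alpha>" "Im \<beta> = d * Re \<alpha>" using a b ab unfolding d_def by algebra+
  ultimately have "\<beta> = \<alpha> * cnj_if (d = -1) \<i>"
    by (auto simp: complex_eq_iff cnj_if_def)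
  then obtain \<sigma> where \<sigma>: "\<beta> = \<alpha> * cnj_if \<sigma> \<i>" by blast
  have z: "Re z * \<alpha> + Im z * \<beta> = \<alpha> * cnj_if \<sigma> z" for z
    unfolding \<sigma> by (auto simp: cnj_if_def complex_eq_iff algebra_simps)
  have "cmod \<alpha> = 1" using a by (simp add: cmod_def power2_eq_square)
  moreover have "z0 (A v) = z0 v + Re (cnj u * \<alpha> * cnj_if \<sigma> (zc v)) + (cmod u)\<^sup>2 / 2 * z3 v" for v
    unfolding z0 mult.assoc z[symmetric] by (simp add: algebra_simps)
  ultimately have "frame_map \<sigma> \<alpha> u (zc k) (z3 k) (\<lambda>v. A v + k)"
    unfolding frame_map_def by (auto simp: coords_add z3 zc z)
  moreover have "z0 (A (pt (1/2) 0 1)) = (1 + (cmod u)\<^sup>2) / 2" by (simp add: z0 add_divide_distrib)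
  ultimately show ?thesis using z3 by auto
qed

end

section \<open>Construction of a null frame and of the reference vector\<close>

lemma projection_fixes_span:
  assumes "linear \<pi>" "\<And>s. s \<in> S \<Longrightarrow> \<pi> s = s" "x \<in> span S"
  shows "\<pi> x = x"
  using linear_eq_on_span[OF assms(1) linear_id, of S x] assms(2,3) by simp

context lorentz_cone begin

text \<open>Gram-Schmidt orthogonalization: \<open>q\<close> is the null vector in the plane of
  \<open>p\<close> and \<open>e\<close> with \<open>l p q = 1\<close>, and \<open>a\<close> and
  \<open>b\<close> are normalized remainders of successive projections.\<close>

lemma null_frame_exists:
  assumes dim: "DIM('a) = 4" and p: "l p e = 1" "l p p = 0" and q: "q = e - (1/2) *\<^sub>R p"
  shows "\<exists>a b. null_frame (\<lambda>v. l v q) (\<lambda>v. l v p) (\<lambda>v. Complex (- l v a) (- l v b))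
      (\<lambda>x z t. x *\<^sub>R p + Re z *\<^sub>R a + Im z *\<^sub>R b + t *\<^sub>R q) \<and>
    (\<forall>v w. l v w = l v q * l w p + l v p * l w q - l v a * l w a - l v b * l w b)"
proof -
  have s: "l e p = 1" using p(1) sym by metis
  have pq: "l p q = 1" "l q p = 1" "l q q = 0"
    by (simp_all add: q l_simps p e s)
  \<comment> \<open>Orthogonality to \<open>p\<close> and \<open>q\<close> implies orthogonality to
    \<open>e\<close>, so \<open>l x x < 0\<close> and \<open>x\<close> can be scaled to norm
    \<open>-1\<close>.\<close>
  have normalise: "\<exists>r. l r r = -1 \<and> l r p = 0 \<and> l r q = 0 \<and> (\<forall>c. l x c = 0 \<longrightarrow> l r c = 0)"
    if x: "x \<noteq> 0" "l x p = 0" "l x q = 0" for x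
  proof -
    have "l x e = 0" using x(2,3) unfolding q by (simp add: l_simps)
    then have n: "l x x < 0" using neg x(1) by blast
    define r where "r = (1 / sqrt (- l x x)) *\<^sub>R x"
    have "sqrt (- l x x) * sqrt (- l x x) = - l x x" using n by simp
    then have "l r r = -1" using n by (simp add: r_def l_simps)
    then show ?thesis using x by (intro exI[of _ r]) (auto simp: r_def l_simps)
  qed
  have miss: "\<exists>v. \<pi> v \<noteq> v" if "finite S" "card S < 4" "\<And>v. \<pi> v \<in> span S" for \<pi> :: "'a \<Rightarrow> 'a" and S
  proof (rule ccontr)
    assume "\<not> ?thesis"
    then have "UNIV \<subseteq> span S" using that(3) by (metis subsetI)
    then have "dim (UNIV :: 'a set) \<le> card S" using that(1) by (rule dim_le_card)
    then show False using that(2) dim by simp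
  qed
  have lin_l: "linear (\<lambda>v. l v c *\<^sub>R x)" for c x
    by (rule linearI) (simp_all add: l_simps scaleR_add_left)
  define \<pi>0 where "\<pi>0 v = l v q *\<^sub>R p + l v p *\<^sub>R q" for v
  have l0: "linear \<pi>0" unfolding \<pi>0_def by (intro linear_compose_add lin_l)
  obtain v where "\<pi>0 v \<noteq> v"
  proof -
    have "\<pi>0 v \<in> span {p, q}" for v
      unfolding \<pi>0_def by (intro span_add span_scale span_base) auto
    moreover have "card {p, q} < 4" using card_length[of "[p, q]"] by simp
    ultimately show thesis using miss[of "{p, q}" \<pi>0] that by blast
  qed
  then obtain a where a: "l a a = -1" "l a p = 0" "l a q = 0"
    using normalise[of "v - \<pi>0 v"] by (auto simp: \<pi>0_def l_simps p pq)
  have a': "l p a = 0" "l q a = 0" using a sym by metis+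
  define \<pi>1 where "\<pi>1 v = \<pi>0 v + l v a *\<^sub>R (- a)" for v
  have l1: "linear \<pi>1" unfolding \<pi>1_def by (intro linear_compose_add lin_l l0)
  have "\<pi>1 v \<in> span {p, q, a}" for v
    unfolding \<pi>1_def \<pi>0_def by (intro span_add span_scale span_neg span_base) auto
  moreover have "card {p, q, a} < 4" using card_length[of "[p, q, a]"] by simp
  ultimately obtain v1 where "\<pi>1 v1 \<noteq> v1"
    using miss[of "{p, q, a}" \<pi>1] by blast
  then obtain b where b: "l b b = -1" "l b p = 0" "l b q = 0" "l b a = 0"
    using normalise[of "v1 - \<pi>1 v1"] by (auto simp: \<pi>1_def \<pi>0_def l_simps p pq a a')
  have b': "l p b = 0" "l q b = 0" "l a b = 0" using b sym by metis+
  define \<pi>2 where "\<pi>2 v = \<pi>1 v + l v b *\<^sub>R (- b)" for v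
  have l2: "linear \<pi>2" unfolding \<pi>2_def by (intro linear_compose_add lin_l l1)
  note defs = \<pi>2_def \<pi>1_def \<pi>0_def
  note vals = p pq a a' b b'
  \<comment> \<open>A nonzero remainder would extend the frame to five independent vectors: each
    projection fixes the span of the earlier vectors and annihilates the next one.\<close>
  have full: "\<pi>2 v = v" for v
  proof (rule ccontr)
    assume "\<pi>2 v \<noteq> v"
    define r where "r = v - \<pi>2 v"
    have r: "r \<noteq> 0" "l r p = 0" "l r q = 0" "l r a = 0" "l r b = 0"
      using \<open>\<pi>2 v \<noteq> v\<close> by (simp_all add: r_def defs l_simps vals)
    have p0: "p \<noteq> 0" using p by (auto simp: l_simps)
    have nq: "q \<notin> span {p}"
    proof
      assume "q \<in> span {p}"
      then obtain c where "q = c *\<^sub>R p" by (auto simp: span_singleton)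
      then show False using pq(2) p(2) by (simp add: l_simps)
    qed
    have na: "a \<notin> span {q, p}"
    proof
      assume "a \<in> span {q, p}"
      then have "\<pi>0 a = a" by (rule projection_fixes_span[OF l0, rotated]) (auto simp: defs vals)
      then have "a = 0" by (simp add: defs vals)
      then show False using a(1) by (simp add: l_simps)
    qed
    have nb: "b \<notin> span {a, q, p}"
    proof
      assume "b \<in> span {a, q, p}"
      then have "\<pi>1 b = b" by (rule projection_fixes_span[OF l1, rotated]) (auto simp: defs vals)
      then have "b = 0" by (simp add: defs vals)
      then show False using b(1) by (simp add: l_simps)
    qed
    have nr: "r \<notin> span {b, a, q, p}"
    proof
      assume "r \<in> span {b, a, q, p}"
      then have "\<pi>2 r = r" by (rule projection_fixes_span[OF l2, rotated]) (auto simp: defs vals)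
      then show False using r by (simp add: defs)
    qed
    have "independent {r, b, a, q, p}"
      by (intro independent_insertI nr nb na nq independent_empty) (simp add: p0)
    moreover have "x \<notin> S" if "x \<notin> span S" for x and S :: "'a set" using that span_base by blast
    note this[OF nr] this[OF nb] this[OF na] this[OF nq]
    then have "card {r, b, a, q, p} = 5" by simp
    ultimately show False using independent_card_le[of "{r, b, a, q, p}"] dim by simp
  qed
  have expand: "v = l v q *\<^sub>R p + l v p *\<^sub>R q + l v a *\<^sub>R (- a) + l v b *\<^sub>R (- b)" for v
    using full[of v] by (simp add: defs)
  have "null_frame (\<lambda>v. l v q) (\<lambda>v. l v p) (\<lambda>v. Complex (- l v a) (- l v b))
      (\<lambda>x z t. x *\<^sub>R p + Re z *\<^sub>R a + Im z *\<^sub>R b + t *\<^sub>R q)"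
  proof
    show "l v q *\<^sub>R p + Re (Complex (- l v a) (- l v b)) *\<^sub>R a + Im (Complex (- l v a) (- l v b)) *\<^sub>R b
        + l v p *\<^sub>R q = v" for v
      using expand[of v] by (simp add: algebra_simps)
  qed (simp_all add: l_simps vals complex_eq_iff)
  moreover have "l v w = l v q * l w p + l v p * l w q - l v a * l w a - l v b * l w b" for v w
  proof -
    have "l v w = l (l v q *\<^sub>R p + l v p *\<^sub>R q + l v a *\<^sub>R (- a) + l v b *\<^sub>R (- b)) w"
      using expand[of v] by simp
    also have "\<dots> = l v q * l p w + l v p * l q w - l v a * l a w - l v b * l b w"
      by (simp add: l_simps)
    finally show ?thesis by (simp add: sym[of _ w])
  qed
  ultimately show ?thesis by blast
qed

end

text \<open>The timelike vector of an orthogonal basis, or its negative, lies in \<open>C\<close>;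
  expansion in the basis shows that its complement is negative definite.\<close>

lemma lorentz_cone_exists:
  fixes l :: "'a::euclidean_space \<Rightarrow> 'a \<Rightarrow> real"
  assumes "lorentzian_form l" and tc: "time_cone l C"
  shows "\<exists>e. lorentz_cone l C e"
proof -
  obtain B e where bil: "bilinear l" and sym: "\<And>x y. l x y = l y x"
    and B: "independent B" "span B = UNIV" "e \<in> B" "l e e = 1"
    "\<And>b. b \<in> B - {e} \<Longrightarrow> l b b = -1" "\<And>b c. b \<in> B \<Longrightarrow> c \<in> B \<Longrightarrow> b \<noteq> c \<Longrightarrow> l b c = 0"
    using assms(1) unfolding lorentzian_form_def by blast
  have fin: "finite B" using B(1) independent_imp_finite by blast
  have neg: "l w w < 0" if w: "l w e = 0" "w \<noteq> 0" for w
  proof -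
    have "w \<in> span B" using B(2) by simp
    then obtain u where u: "w = (\<Sum>b\<in>B. u b *\<^sub>R b)" unfolding span_finite[OF fin] by blast
    have lsum: "l w x = (\<Sum>b\<in>B. u b * l b x)" for x
      using linear_sum[of "\<lambda>v. l v x" "\<lambda>b. u b *\<^sub>R b" B] bil
      unfolding u by (simp add: bilinear_def bilinear_lmul[OF bil])
    have wb: "l w c = u c * l c c" if c: "c \<in> B" for c
    proof -
      have "(\<Sum>b\<in>B. u b * l b c) = (\<Sum>b\<in>B. if b = c then u c * l c c else 0)"
        using B(6) c by (intro sum.cong) auto
      then show ?thesis using lsum fin c by (simp add: sum.delta)
    qed
    have ue: "u e = 0" using wb[OF B(3)] w(1) B(4) by simp
    have "l w w = (\<Sum>b\<in>B. u b * l w b)" using lsum[of w] sym by simp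
    also have "\<dots> = (\<Sum>b\<in>B. - (u b)\<^sup>2)"
    proof (rule sum.cong)
      fix b assume b: "b \<in> B"
      show "u b * l w b = - (u b)\<^sup>2"
        using wb[OF b] B(5)[of b] b ue by (cases "b = e") (auto simp: power2_eq_square)
    qed simp
    finally have eq: "l w w = - (\<Sum>b\<in>B. (u b)\<^sup>2)" by (simp add: sum_negf)
    obtain b where b: "b \<in> B" "u b \<noteq> 0" using w(2) unfolding u by (metis (no_types, lifting) scaleR_eq_0_iff sum.neutral)
    have "(\<Sum>b\<in>B. (u b)\<^sup>2) > 0" using b fin by (intro sum_pos2[of _ b]) auto
    then show ?thesis using eq by simp
  qed
  have union: "C \<union> uminus ` C = {v. l v v \<ge> 0}" using tc by (simp add: time_cone_def)
  have "e \<in> C \<union> uminus ` C" unfolding union using B(4) by simp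
  then show ?thesis
  proof
    assume "e \<in> C"
    then have "lorentz_cone l C e" using bil sym tc B(4) neg by unfold_locales auto
    then show ?thesis ..
  next
    assume "e \<in> uminus ` C"
    then have "- e \<in> C" by auto
    then have "lorentz_cone l C (- e)" using bil sym tc B(4) neg
      by unfold_locales (auto simp: bilinear_lneg[OF bil] bilinear_rneg[OF bil])
    then show ?thesis ..
  qed
qed

section \<open>Causality expressed by the form and by the linear parts\<close>

context flat_lorentzian begin

text \<open>Otherwise, after exchanging \<open>g\<close> and \<open>h\<close> if necessary, the
  difference lies in \<open>C\<close>, and \<open>g\<close> composed with the inverse of
  \<open>h\<close> moves \<open>h v\<close> into its own future.\<close>

lemma spacelike:
  assumes cone: "lorentz_cone l C e" and gh: "g \<in> \<Gamma>" "h \<in> \<Gamma>" "g \<noteq> h"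
  shows "l (g v - h v) (g v - h v) < 0"
proof (rule ccontr)
  interpret lorentz_cone l C e by fact
  assume n: "\<not> ?thesis"
  have "g v - h v \<in> C \<or> - (g v - h v) \<in> C" using n by (intro C_cases) simp
  then obtain g h where *: "g \<in> \<Gamma>" "h \<in> \<Gamma>" "g \<noteq> h" "g v - h v \<in> C" using gh by (metis minus_diff_eq)
  obtain k where k: "k \<in> \<Gamma>" "k \<circ> h = id" "h \<circ> k = id" using inv_ex *(2) by blast
  have kh: "k (h x) = x" for x using k(2) by (metis comp_apply id_apply)
  have "(g \<circ> k) (h v) - h v \<in> C" using *(4) by (simp add: kh)
  then have "g \<circ> k = id" using acausal[OF comp_in[OF *(1) k(1)]] by blast
  then have "g (k (h x)) = h x" for x by (metis comp_apply id_apply)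
  then show False using *(3) by (auto simp: kh)
qed

text \<open>For the last axiom, a timelike \<open>g w - w\<close> would outweigh the translation
  part at a distant point \<open>s *\<^sub>R w\<close> and make the affine displacement there
  timelike.\<close>

lemma lorentz_group:
  assumes cone: "lorentz_cone l C e"
  shows "lorentz_group l C e (linear_part ` \<Gamma>)"
proof -
  interpret lorentz_cone l C e by fact
  show ?thesis
  proof (intro lorentz_group.intro lorentz_group_axioms.intro)
    show "lorentz_cone l C e" by fact
    show "id \<in> linear_part ` \<Gamma>" using id_in linear_part_id by (metis image_eqI)
    show "g \<circ> h \<in> linear_part ` \<Gamma>" if "g \<in> linear_part ` \<Gamma>" "h \<in> linear_part ` \<Gamma>" for g h
    proof -
      obtain g' h' where "g' \<in> \<Gamma>" "h' \<in> \<Gamma>" "g = linear_part g'" "h = linear_part h'" using \<open>g \<in> _\<close> \<open>h \<in> _\<close> by blast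
      then show ?thesis using linear_part_comp[of g' h'] comp_in[of g' h'] by (metis imageI)
    qed
    show "\<exists>h\<in>linear_part ` \<Gamma>. g \<circ> h = id \<and> h \<circ> g = id" if g: "g \<in> linear_part ` \<Gamma>" for g
    proof -
      obtain k where k: "k \<in> \<Gamma>" "g = linear_part k" using g by blast
      then obtain h where h: "h \<in> \<Gamma>" "k \<circ> h = id" "h \<circ> k = id" using inv_ex by blast
      have "g \<circ> linear_part h = id" "linear_part h \<circ> g = id"
        using linear_part_comp[OF k(1), of h] linear_part_comp[OF h(1), of k] h(2,3) k(2)
        by (simp_all add: linear_part_id)
      then show ?thesis using h(1) by blast
    qed
    show "linear g" if "g \<in> linear_part ` \<Gamma>" for g using that lin by blast
    show "l (g x) (g y) = l x y" if "g \<in> linear_part ` \<Gamma>" for g x y using that isom by blast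
    show "g x \<in> C" if "g \<in> linear_part ` \<Gamma>" "x \<in> C" for g x using that pres by blast
    show "l (g w - w) (g w - w) \<le> 0" if g: "g \<in> linear_part ` \<Gamma>" for g w
    proof (rule ccontr)
      assume n: "\<not> ?thesis"
      obtain k where k: "k \<in> \<Gamma>" "g = linear_part k" using g by blast
      have "k \<noteq> id"
      proof
        assume "k = id"
        then have "g w = w" using k(2) by (simp add: linear_part_id)
        then show False using n by (simp add: l_simps)
      qed
      define x where "x = g w - w"
      define A B D where "A = l x x" and "B = l x (k 0)" and "D = l (k 0) (k 0)"
      have A: "A > 0" using n by (simp add: A_def x_def)
      have lt: "s * (s * A + 2 * B) + D < 0" for s
      proof -
        have "k (s *\<^sub>R w) - id (s *\<^sub>R w) = s *\<^sub>R x + k 0"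
          using affine_eq[of k "s *\<^sub>R w"] linear_scale[OF lin[OF k(1)], of s w] k(2)
          by (simp add: x_def algebra_simps)
        then have "l (s *\<^sub>R x + k 0) (s *\<^sub>R x + k 0) < 0"
          using spacelike[OF cone k(1) id_in \<open>k \<noteq> id\<close>] by metis
        then show ?thesis
          by (simp add: l_simps A_def B_def D_def sym[of "k 0" x] algebra_simps)
      qed
      \<comment> \<open>Large enough that \<open>s \<ge> 1\<close> and
        \<open>s * A + 2 * B \<ge> 1 + \<bar>D\<bar>\<close>.\<close>
      define s where "s = (1 + 2 * \<bar>B\<bar> + \<bar>D\<bar>) / A + 1"
      have "s * A = 1 + 2 * \<bar>B\<bar> + \<bar>D\<bar> + A" using A by (simp add: s_def field_simps)
      then have *: "s * A + 2 * B \<ge> 1 + \<bar>D\<bar>" using A by linarith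
      have "s \<ge> 1" using A by (simp add: s_def)
      then have "1 * (1 + \<bar>D\<bar>) \<le> s * (s * A + 2 * B)" using * by (intro mult_mono) auto
      then have "1 + \<bar>D\<bar> \<le> s * (s * A + 2 * B)" by simp
      then show False using lt[of s] by linarith
    qed
  qed
qed

end

section \<open>Choice of the null frame and conjugation to the model\<close>

theorem theorem3:
  fixes l :: "'a::euclidean_space \<Rightarrow> 'a \<Rightarrow> real"
    and C :: "'a set"
    and \<Gamma> :: "('a \<Rightarrow> 'a) set"
  assumes "DIM('a) = 4"
    and "flat_complete_lorentzian l C \<Gamma>"
    and "strictly_causal C \<Gamma>"
    and "\<not> elliptic C \<Gamma>"
  shows "homothetic \<Gamma> l Gamma0 form0"
proof -
  interpret \<Gamma>: flat_lorentzian l C \<Gamma>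
    using assms(2,3) by unfold_locales (simp_all add: strictly_causal_def)
  have "lorentzian_form l" "time_cone l C"
    using assms(2) by (simp_all add: flat_complete_lorentzian_def)
  then obtain e where e: "lorentz_cone l C e" using lorentz_cone_exists by blast
  interpret G: lorentz_group l C e "linear_part ` \<Gamma>" by (rule \<Gamma>.lorentz_group[OF e])
  have unbounded: "\<exists>g\<in>linear_part ` \<Gamma>. l (g e) e > M" for M
    using G.bounded_fixed[of M] assms(4) unfolding elliptic_def by (metis imageI not_le)
  obtain p where p: "p \<in> C" "l p e = 1" "l p p = 0" "\<And>g. g \<in> \<Gamma> \<Longrightarrow> linear_part g p = p"
    using G.unbounded_fixed[OF unbounded] by blast
  define q where "q = e - (1/2) *\<^sub>R p"
  obtain a b where frame: "null_frame (\<lambda>v. l v q) (\<lambda>v. l v p) (\<lambda>v. Complex (- l v a) (- l v b))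
      (\<lambda>x z t. x *\<^sub>R p + Re z *\<^sub>R a + Im z *\<^sub>R b + t *\<^sub>R q)"
    and form: "\<And>v w. l v w = l v q * l w p + l v p * l w q - l v a * l w a - l v b * l w b"
    using G.null_frame_exists[OF assms(1) p(2,3) q_def] by blast
  interpret F: null_frame "\<lambda>v. l v q" "\<lambda>v. l v p" "\<lambda>v. Complex (- l v a) (- l v b)"
      "\<lambda>x z t. x *\<^sub>R p + Re z *\<^sub>R a + Im z *\<^sub>R b + t *\<^sub>R q" by (rule frame)
  have Q: "F.Q v = l v v" for v
    unfolding F.Q_def cmod_power2 by (subst form[of v v]) (simp add: power2_eq_square)
  have e_eq: "e = (1/2) *\<^sub>R p + q" by (simp add: q_def)
  \<comment> \<open>The second conjunct turns unbounded heights of the orbit of \<open>e\<close>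
    into unbounded parameters \<open>u\<close>.\<close>
  have map: "\<exists>\<sigma> \<epsilon> u k. F.frame_map \<sigma> \<epsilon> u (Complex (- l k a) (- l k b)) (l k p) g \<and>
      l (linear_part g e) e = 1 + (cmod u)\<^sup>2 / 2" if g: "g \<in> \<Gamma>" for g
  proof -
    have fixp: "linear_part g (1 *\<^sub>R p + Re 0 *\<^sub>R a + Im 0 *\<^sub>R b + 0 *\<^sub>R q)
        = 1 *\<^sub>R p + Re 0 *\<^sub>R a + Im 0 *\<^sub>R b + 0 *\<^sub>R q"
      using p(4)[OF g] by simp
    have iso: "l (linear_part g v) q * l (linear_part g w) p + l (linear_part g v) p * l (linear_part g w) q
        - Re (Complex (- l (linear_part g v) a) (- l (linear_part g v) b))
          * Re (Complex (- l (linear_part g w) a) (- l (linear_part g w) b))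
        - Im (Complex (- l (linear_part g v) a) (- l (linear_part g v) b))
          * Im (Complex (- l (linear_part g w) a) (- l (linear_part g w) b))
      = l v q * l w p + l v p * l w q
        - Re (Complex (- l v a) (- l v b)) * Re (Complex (- l w a) (- l w b))
        - Im (Complex (- l v a) (- l v b)) * Im (Complex (- l w a) (- l w b))" for v w
      using \<Gamma>.isom[OF g, of v w] form[of v w] form[of "linear_part g v" "linear_part g w"] by simp
    obtain \<sigma> \<epsilon> u where *: "F.frame_map \<sigma> \<epsilon> u (Complex (- l (g 0) a) (- l (g 0) b)) (l (g 0) p) (\<lambda>v. linear_part g v + g 0)"
      "l (linear_part g ((1/2) *\<^sub>R p + Re 0 *\<^sub>R a + Im 0 *\<^sub>R b + 1 *\<^sub>R q)) q = (1 + (cmod u)\<^sup>2) / 2"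
      "l (linear_part g ((1/2) *\<^sub>R p + Re 0 *\<^sub>R a + Im 0 *\<^sub>R b + 1 *\<^sub>R q)) p = 1"
      using F.frame_map_of_affine[where A = "linear_part g" and k = "g 0", OF \<Gamma>.lin[OF g] iso fixp]
      by (elim exE conjE) (rule that)
    have "(\<lambda>v. linear_part g v + g 0) = g" by (rule ext) (rule \<Gamma>.affine_eq[symmetric])
    moreover have "l (linear_part g e) e = l (linear_part g e) p / 2 + l (linear_part g e) q"
      by (subst (2) e_eq) (simp add: G.l_simps)
    moreover have "(1/2) *\<^sub>R p + Re 0 *\<^sub>R a + Im 0 *\<^sub>R b + 1 *\<^sub>R q = e" by (simp add: e_eq)
    ultimately show ?thesis using * by (intro exI[of _ \<sigma>] exI[of _ \<epsilon>] exI[of _ u] exI[of _ "g 0"]) (simp add: add_divide_distrib)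
  qed
  interpret N: null_frame_group "\<lambda>v. l v q" "\<lambda>v. l v p" "\<lambda>v. Complex (- l v a) (- l v b)"
      "\<lambda>x z t. x *\<^sub>R p + Re z *\<^sub>R a + Im z *\<^sub>R b + t *\<^sub>R q" \<Gamma> C
  proof
    show "id \<in> \<Gamma>" by (rule \<Gamma>.id_in)
    show "g \<circ> h \<in> \<Gamma>" if "g \<in> \<Gamma>" "h \<in> \<Gamma>" for g h using \<Gamma>.comp_in that .
    show "\<exists>h\<in>\<Gamma>. g \<circ> h = id \<and> h \<circ> g = id" if "g \<in> \<Gamma>" for g using \<Gamma>.inv_ex that .
    show "\<exists>\<sigma> \<epsilon> u a b. F.frame_map \<sigma> \<epsilon> u a b g" if "g \<in> \<Gamma>" for g using map[OF that] by blast
    show "F.Q (g v - h v) < 0" if "g \<in> \<Gamma>" "h \<in> \<Gamma>" "g \<noteq> h" for g h v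
      unfolding Q using \<Gamma>.spacelike[OF e that] .
    show "\<exists>g\<in>\<Gamma>. \<exists>\<sigma> \<epsilon> u a b. F.frame_map \<sigma> \<epsilon> u a b g \<and> M < cmod u" for M
    proof -
      obtain g where g: "g \<in> \<Gamma>" "l (linear_part g e) e > 1 + M\<^sup>2 / 2" using unbounded by blast
      then obtain \<sigma> \<epsilon> u k where k: "F.frame_map \<sigma> \<epsilon> u (Complex (- l k a) (- l k b)) (l k p) g"
        "l (linear_part g e) e = 1 + (cmod u)\<^sup>2 / 2" using map by blast
      then have "M\<^sup>2 < (cmod u)\<^sup>2" using g(2) by simp
      then have "M < cmod u" by (rule power_less_imp_less_base) simp
      then show ?thesis using g(1) k(1) by blast
    qed
    show "finite {g \<in> \<Gamma>. g v \<in> cball v r}" for v r by (rule \<Gamma>.proper_orbit)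
    show "countable \<Gamma>" by (rule \<Gamma>.countable_group)
    show "v \<in> C" if "0 < l v p" "0 \<le> F.Q v" for v
    proof -
      have "l v v \<ge> 0" using that(2) Q by simp
      then have "v \<in> C \<or> - v \<in> C" by (rule G.C_cases)
      \<comment> \<open>Vectors of \<open>C\<close> pair nonnegatively with \<open>p\<close>, so the
        sign of \<open>l v p\<close> selects the cone.\<close>
      moreover have "- v \<notin> C" using G.l_nonneg[OF _ p(1), of "- v"] that(1) by (auto simp: G.l_simps)
      ultimately show ?thesis by blast
    qed
    show "0 \<le> F.Q v" if "v \<in> C" for v unfolding Q using G.C_nonneg that .
    show "\<exists>N. open N \<and> v \<in> N \<and> open (N - {g (v + s *\<^sub>R c) |g c. g \<in> \<Gamma> \<and> c \<in> C})"
      if "s \<in> {1, -1}" for s v using \<Gamma>.strictly_causal_closed[OF assms(3) that] .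
  qed
  obtain F A k \<tau> where F: "\<tau> > 0" "linear A" "\<And>v. F v = A v + k" "bij F"
    "\<And>x y. form0 (A x) (A y) = \<tau> * (l x q * l y p + l x p * l y q
        - Re (Complex (- l x a) (- l x b)) * Re (Complex (- l y a) (- l y b))
        - Im (Complex (- l x a) (- l x b)) * Im (Complex (- l y a) (- l y b)))"
    "\<And>g. g \<in> \<Gamma> \<Longrightarrow> \<exists>n. \<forall>v. F (g v) = gamma0 n (F v)" "\<And>n. \<exists>g\<in>\<Gamma>. \<forall>v. F (g v) = gamma0 n (F v)"
    using N.conjugate_to_Gamma0 by blast
  show ?thesis
  proof (rule homothetic_of_affine_conjugacy[OF F(2,3,4,1)])
    show "form0 (A x) (A y) = \<tau> * l x y" for x y unfolding F(5) form[of x y] by simp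
    show "\<exists>g'\<in>Gamma0. \<forall>v. F (g v) = g' (F v)" if "g \<in> \<Gamma>" for g
      using F(6)[OF that] unfolding Gamma0_def by blast
    show "\<exists>g\<in>\<Gamma>. \<forall>v. F (g v) = g' (F v)" if "g' \<in> Gamma0" for g'
      using F(7) that unfolding Gamma0_def by blast
  qed
qed

end
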